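(* For every $\tau\in\mathbb{H}^2$ set $$t(\tau)=\frac{\eta^4(\tau/2)\,\eta^8(3\tau)}{\eta^8(\tau)\,\eta^4(3\tau/2)},\qquad T(\tau)=\frac{\eta^6(\tau)\,\eta(3\tau/2)}{\eta^3(\tau/2)\,\eta^2(3\tau)} .$$ Then the inverse function $\tau=\tau(t)$ yields $T(t)=T(\tau(t))$, and $T(t)$ satisfies Heun's differential equation $$\frac{d^2T}{dt^2}+\left\{\frac1t+\frac{1}{t-1}+\frac{1}{t-\frac19}\right\}\frac{dT}{dt}+\frac{t-\frac13}{t(t-1)\left(t-\frac19\right)}\,T=0 .$$
   Context: $\mathbb{H}^2=\{\tau\in\mathbb{C}\mid \Im\tau>0\}$; $\eta(\tau)=e^{2\pi i\tau/24}\prod_{n\ge1}(1-e^{2\pi i n\tau})$ is the Dedekind eta function and $\eta^k(r\tau)=(\eta(r\tau))^k$. The inverse function $\tau=\tau(t)$ means any local holomorphic inverse of $\tau\mapsto t(\tau)$; thus $T$ is regarded locally as a function of the variable $t$. *)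

theory Defs
  imports "HOL-Analysis.Analysis"
begin

definition upper_half_plane :: "complex set" where
  "upper_half_plane = {\<tau>. Im \<tau> > 0}"

text \<open>
  The factor with index \<open>n\<close> of the product is \<open>1 - q ^ (n + 1)\<close>, where \<open>q = exp (2 \<pi> i \<tau>)\<close>, so the
  product runs over all positive integers. The definition is meant for \<open>\<tau>\<close> in the upper half plane,
  where the product converges.
\<close>

definition dedekind_eta :: "complex \<Rightarrow> complex" where
  "dedekind_eta \<tau> =
     exp (2 * of_real pi * \<i> * \<tau> / 24) *
     (\<Prod>n. 1 - exp (2 * of_real pi * \<i> * of_nat (n + 1) * \<tau>))"

definition heun_t :: "complex \<Rightarrow> complex" where
  "heun_t \<tau> =
     (dedekind_eta (\<tau> / 2) ^ 4 * dedekind_eta (3 * \<tau>) ^ 8) /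
     (dedekind_eta \<tau> ^ 8 * dedekind_eta (3 * \<tau> / 2) ^ 4)"

definition heun_T :: "complex \<Rightarrow> complex" where
  "heun_T \<tau> =
     (dedekind_eta \<tau> ^ 6 * dedekind_eta (3 * \<tau> / 2)) /
     (dedekind_eta (\<tau> / 2) ^ 3 * dedekind_eta (3 * \<tau>) ^ 2)"

text \<open>
  \<open>g\<close> is a holomorphic inverse, on the open set \<open>U\<close>, of the function \<open>f\<close> with domain \<open>S\<close>. The
  equation \<open>g (f \<tau>) = \<tau>\<close> for \<open>\<tau> \<in> g ` U\<close> follows from the last conjunct.
\<close>

definition local_holomorphic_inverse ::
  "(complex \<Rightarrow> complex) \<Rightarrow> complex set \<Rightarrow> complex set \<Rightarrow> (complex \<Rightarrow> complex) \<Rightarrow> bool" where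
  "local_holomorphic_inverse f S U g \<longleftrightarrow>
     open U \<and> g holomorphic_on U \<and> g ` U \<subseteq> S \<and> (\<forall>w\<in>U. f (g w) = w)"

end

theory Submission
  imports Defs "HOL-Complex_Analysis.Complex_Analysis"
begin

text \<open>
Write \<open>w = \<pi> \<i> \<tau>\<close> and \<open>q = exp w\<close>, so that \<open>\<eta>(\<tau> / 2)\<close>, \<open>\<eta>(\<tau>)\<close>, \<open>\<eta>(3 \<tau> / 2)\<close>, \<open>\<eta>(3 \<tau>)\<close>
are the eta functions in \<open>q\<close>, \<open>q\<^sup>2\<close>, \<open>q\<^sup>3\<close>, \<open>q\<^sup>6\<close>, and let a dash denote \<open>d/dw\<close>. Heun's equation is the
self-adjoint form \<open>d/dt (P dT/dt) = 3 (1 - 3 t) T\<close> with \<open>P = t (1 - t) (1 - 9 t)\<close>, and it follows by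
the chain rule from two identities of level 6,

  \<open>t' = P T\<^sup>2\<close>   and   \<open>u' = u\<^sup>2 + 3 (1 - 3 t) P T\<^sup>4\<close>,   where \<open>u = T' / T\<close>.

The first also shows that \<open>t\<close> avoids \<open>0\<close>, \<open>1\<close>, \<open>1/9\<close> wherever it has a local inverse, since there
\<open>t' \<noteq> 0\<close> (lemma \<open>level6_system\<close>).

Both identities come from the elliptic curve \<open>\<complex> / (2 \<pi> \<i> \<int> + w \<int>)\<close> with its point \<open>\<pi> \<i> / 3\<close> of order
6. A regularised sum of \<open>(1 + exp u) / (2 (1 - exp u))\<close> over \<open>u \<in> v + w \<int>\<close> is a quasi-periodic
Weierstrass zeta function \<open>\<rho>(v)\<close>, and a weighted version \<open>S(v)\<close> of the sum is the \<open>w\<close>-derivative of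
the logarithm of a theta function. Summing the addition theorem of the hyperbolic cotangent over
\<open>\<int> \<times> \<int>\<close> gives the addition theorem

  \<open>\<rho>(a) \<rho>(b) - \<rho>(a + b) (\<rho>(a) + \<rho>(b)) + S(a) + S(b) + S(a + b) = - 1/4\<close>

(\<open>qzeta_add\<close>) and its degenerate case \<open>b = - a\<close> (\<open>qzeta_square\<close>), with absolutely convergent series
throughout. Evaluated at multiples of \<open>\<pi> \<i> / 3\<close>, these express \<open>S(k \<pi> \<i> / 3) + 1/12\<close> for
\<open>k = 1, 2, 3\<close> as quadratic forms in \<open>\<alpha> = \<rho>(\<pi> \<i> / 3)\<close> and \<open>\<beta> = \<rho>(2 \<pi> \<i> / 3)\<close>. Moreover
\<open>\<rho>\<^sub>w = - S\<^sub>v\<close>, so the \<open>v\<close>-derivatives of the two theorems give the \<open>w\<close>-derivatives of \<open>\<alpha>\<close>, \<open>\<beta>\<close>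
and of \<open>\<kappa> = E\<^sub>2(q) / 12\<close> as polynomials in \<open>\<alpha>\<close>, \<open>\<beta>\<close>, \<open>\<kappa>\<close> (\<open>alpha_deriv\<close>, \<open>beta_deriv\<close>,
\<open>kappa_deriv\<close>); this is a level 6 analogue of Ramanujan's differential system for the Eisenstein
series.

A product \<open>\<Prod>(1 - z q\<^sup>m) (1 - q\<^sup>m / z)\<close> at a sixth root of unity \<open>z \<noteq> 1\<close> is a quotient of eta
functions up to a power of \<open>q\<close>. Hence the logarithmic derivatives of \<open>t\<close> and \<open>T\<close> are linear
combinations of \<open>1\<close>, \<open>\<kappa>\<close> and the \<open>S(k \<pi> \<i> / 3)\<close>, that is, polynomials in \<open>\<alpha>\<close>, \<open>\<beta>\<close>, \<open>\<kappa>\<close>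
(\<open>level6_deriv\<close>). Comparison with the differential system shows that
\<open>(\<alpha> + \<beta>) / T\<close> and \<open>(\<alpha> - 3 \<beta>) / (t T)\<close> are constant, and their values are found by letting \<open>q\<close> tend to
\<open>0\<close>. So \<open>\<alpha>\<close> and \<open>\<beta>\<close> are known in terms of \<open>t\<close> and \<open>T\<close> (\<open>alpha_beta_conv_level6\<close>), and the two
identities above become identities between polynomials.
\<close>

section \<open>Convolution of regularised sums over the integers\<close>

text \<open>
The two-sided limits of \<open>(1 + exp u) / (2 (1 - exp u))\<close> along \<open>u = v + m w\<close> for
\<open>Re w < 0\<close>: subtracting them from the terms makes the series over \<open>m\<close> converge absolutely.
\<close>

definition half_sgn :: "int \<Rightarrow> real" where
  "half_sgn m = of_int (sgn m) / 2"

lemma half_sgn_minus [simp]: "half_sgn (- m) = - half_sgn m"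
  by (simp add: half_sgn_def sgn_if)

lemma half_sgn_0 [simp]: "half_sgn 0 = 0"
  by (simp add: half_sgn_def)

text \<open>
The sum telescopes: a shift by one loses one full step of height 1. This is the source of all the
weights \<open>m\<close> in the convolution theorem below.
\<close>

lemma has_sum_half_sgn_shift: "((\<lambda>n. half_sgn n - half_sgn (m + n)) has_sum - of_int m) UNIV"
proof -
  have step: "((\<lambda>n. half_sgn (k + n) - half_sgn (k + 1 + n)) has_sum -1) UNIV" for k
  proof -
    have "((\<lambda>n. half_sgn n - half_sgn (n + 1)) has_sum -1) UNIV"
      by (rule has_sum_finite_neutralI[of "{-1, 0}"]) (auto simp: half_sgn_def sgn_if)
    also have "?this \<longleftrightarrow> ?thesis"
      by (rule has_sum_reindex_bij_witness[of _ "\<lambda>n. k + n" "\<lambda>n. n - k"]) (auto simp: algebra_simps)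
    finally show ?thesis .
  qed
  show ?thesis
  proof (induction m rule: int_induct[where k = 0])
    case (step1 i)
    from has_sum_add[OF step1(2) step[of i]] show ?case
      by (simp add: algebra_simps)
  next
    case (step2 i)
    from has_sum_add[OF step2(2) has_sum_uminusI[OF step[of "i - 1"]]] show ?case
      by (simp add: algebra_simps)
  qed auto
qed

lemma has_sum_norm_half_sgn_shift:
  "((\<lambda>n. norm (half_sgn n - half_sgn (m + n))) has_sum of_int \<bar>m\<bar>) UNIV"
proof -
  have "((\<lambda>n. - sgn (of_int m) * (half_sgn n - half_sgn (m + n))) has_sum
           - sgn (of_int m) * - of_int m) UNIV"
    by (intro has_sum_cmult_right has_sum_half_sgn_shift)
  moreover have "- sgn (of_int m) * (half_sgn n - half_sgn (m + n)) =
      norm (half_sgn n - half_sgn (m + n))" for n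
    by (auto simp: half_sgn_def sgn_if)
  moreover have "- sgn (of_int m) * - of_int m = (of_int \<bar>m\<bar> :: real)"
    by (auto simp: sgn_if)
  ultimately show ?thesis by simp
qed

lemma has_sum_Times_iterated:
  fixes a :: "int \<Rightarrow> int \<Rightarrow> complex"
  assumes inner: "\<And>m. (a m has_sum b m) UNIV"
    and norms: "\<And>m. ((\<lambda>n. norm (a m n)) has_sum c m) UNIV"
    and "c summable_on UNIV" and "(b has_sum s) UNIV"
  shows "((\<lambda>(m, n). a m n) has_sum s) UNIV"
proof -
  have "(\<lambda>p. norm (case p of (m, n) \<Rightarrow> a m n)) summable_on UNIV \<times> UNIV"
    by (rule summable_on_SigmaI[where g = c]) (use assms in auto)
  hence "(\<lambda>(m, n). a m n) summable_on UNIV \<times> UNIV"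
    by (rule abs_summable_summable)
  hence "((\<lambda>(m, n). a m n) has_sum s) (UNIV \<times> UNIV)"
    by (intro has_sum_SigmaI[where g = b]) (use assms in auto)
  thus ?thesis by simp
qed

lemma has_sum_int_pairs_swap:
  "((\<lambda>(m, n). a m n) has_sum s) (UNIV :: (int \<times> int) set) \<longleftrightarrow> ((\<lambda>(m, n). a n m) has_sum s) UNIV"
  by (rule has_sum_reindex_bij_witness[of _ prod.swap prod.swap]) auto

lemma has_sum_int_pairs_shear:
  "((\<lambda>(m, n). a (m + n) m) has_sum s) (UNIV :: (int \<times> int) set) \<longleftrightarrow>
   ((\<lambda>(k, m). a k m) has_sum s) UNIV"
  by (rule has_sum_reindex_bij_witness[of _ "\<lambda>(k, m). (m, k - m)" "\<lambda>(m, n). (m + n, m)"]) auto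

text \<open>
Let \<open>c\<close>, \<open>d\<close>, \<open>e\<close> be sequences with \<open>c(m) d(n) + 1/4 = e(m + n) (c(m) + d(n))\<close>, each tending to
\<open>\<plusminus> 1/2\<close> at \<open>\<plusminus> \<infinity>\<close>. Neither side is summable over \<open>\<int> \<times> \<int>\<close>, but after writing every sequence as
\<open>half_sgn\<close> plus a rapidly decreasing part, the products of two signs cancel against \<open>1/4\<close> except at
the origin, and each of the remaining families is absolutely summable. The term \<open>r\<close> accounts for a
failure of the relation on the antidiagonal, which occurs when \<open>e\<close> has a pole at \<open>0\<close>.
\<close>

lemma regularised_convolution:
  fixes f g h r :: "int \<Rightarrow> complex"
  assumes rel: "\<And>m n. (half_sgn m + f m) * (half_sgn n + g n) + 1 / 4 =
       (half_sgn (m + n) + h (m + n)) * ((half_sgn m + f m) + (half_sgn n + g n)) +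
       (if m + n = 0 then r m else 0)"
    and abs: "(\<lambda>m. norm (f m)) summable_on UNIV" "(\<lambda>m. norm (g m)) summable_on UNIV"
      "(\<lambda>m. norm (h m)) summable_on UNIV"
    and abs1: "(\<lambda>m. norm (of_int m * f m)) summable_on UNIV"
      "(\<lambda>m. norm (of_int m * g m)) summable_on UNIV"
      "(\<lambda>m. norm (of_int m * h m)) summable_on UNIV"
    and r: "(r has_sum R) UNIV"
    and fgh: "(f has_sum F) UNIV" "(g has_sum G) UNIV" "(h has_sum H) UNIV"
    and fgh1: "((\<lambda>m. of_int m * f m) has_sum F1) UNIV" "((\<lambda>m. of_int m * g m) has_sum G1) UNIV"
      "((\<lambda>m. of_int m * h m) has_sum H1) UNIV"
  shows "F * G - H * (F + G) - F1 - G1 - H1 + 1 / 4 = R"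
proof -
  let ?s = "\<lambda>m. complex_of_real (half_sgn m)"
  have shift: "((\<lambda>(m, n). c m * (?s n - ?s (m + n))) has_sum - C) UNIV"
    if c: "(\<lambda>m. norm (of_int m * c m)) summable_on UNIV" "((\<lambda>m. of_int m * c m) has_sum C) UNIV"
    for c C
  proof (rule has_sum_Times_iterated)
    fix m
    have "((\<lambda>n. of_real (half_sgn n - half_sgn (m + n)) :: complex) has_sum of_real (- of_int m)) UNIV"
      by (rule has_sum_of_real[OF has_sum_half_sgn_shift])
    from has_sum_cmult_right[OF this, of "c m"]
    show "((\<lambda>n. c m * (?s n - ?s (m + n))) has_sum - (of_int m * c m)) UNIV"
      by (simp add: mult_ac)
    from has_sum_cmult_right[OF has_sum_norm_half_sgn_shift[of m], of "norm (c m)"]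
    show "((\<lambda>n. norm (c m * (?s n - ?s (m + n)))) has_sum norm (of_int m * c m)) UNIV"
      unfolding norm_mult of_real_diff[symmetric] norm_of_real
      by (simp add: mult_ac norm_mult)
  qed (use c in \<open>auto intro: has_sum_uminusI\<close>)
  have prod: "((\<lambda>(m, n). c m * d n) has_sum C * D) UNIV"
    if c: "(\<lambda>m. norm (c m)) summable_on UNIV" "(c has_sum C) UNIV"
    and d: "(\<lambda>m. norm (d m)) summable_on UNIV" "(d has_sum D) UNIV"
    for c d :: "int \<Rightarrow> complex" and C D
  proof (rule has_sum_Times_iterated)
    fix m
    show "((\<lambda>n. c m * d n) has_sum c m * D) UNIV"
      by (intro has_sum_cmult_right d)
    show "((\<lambda>n. norm (c m * d n)) has_sum (norm (c m) * (\<Sum>\<^sub>\<infinity>n. norm (d n)))) UNIV"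
      unfolding norm_mult by (intro has_sum_cmult_right has_sum_infsum d)
  qed (use c in \<open>auto intro: has_sum_cmult_left summable_on_cmult_left\<close>)
  have A: "((\<lambda>(m, n). f m * (?s n - ?s (m + n))) has_sum - F1) UNIV"
    by (rule shift) fact+
  have B: "((\<lambda>(m, n). g n * (?s m - ?s (m + n))) has_sum - G1) UNIV"
    using shift[OF abs1(2) fgh1(2)]
    by (subst has_sum_int_pairs_swap) (simp add: add.commute)
  have C: "((\<lambda>(m, n). f m * g n) has_sum F * G) UNIV"
    by (rule prod) fact+
  have D: "((\<lambda>(m, n). h (m + n) * f m) has_sum H * F) UNIV"
    using prod[OF abs(3) fgh(3) abs(1) fgh(1)]
    by (subst has_sum_int_pairs_shear)
  have "((\<lambda>(m, n). h (m + n) * g m) has_sum H * G) UNIV"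
    using prod[OF abs(3) fgh(3) abs(2) fgh(2)]
    by (subst has_sum_int_pairs_shear)
  hence D': "((\<lambda>(m, n). h (m + n) * g n) has_sum H * G) UNIV"
    by (subst has_sum_int_pairs_swap) (simp add: add.commute)
  have "((\<lambda>(k, n). - (h k * (?s n - ?s (k + n)))) has_sum H1) UNIV"
    using has_sum_uminusI[OF shift[OF abs1(3) fgh1(3)]] by (simp add: case_prod_unfold)
  also have "?this \<longleftrightarrow> ((\<lambda>(m, n). h (m + n) * (?s m + ?s n)) has_sum H1) UNIV"
  proof (rule has_sum_reindex_bij_witness[of _ "\<lambda>(m, n). (m + n, - n)" "\<lambda>(k, n). (k + n, - n)"], goal_cases)
    case (5 a)
    then show ?case by (auto simp: case_prod_unfold algebra_simps)
  qed auto
  finally have E: "((\<lambda>(m, n). h (m + n) * (?s m + ?s n)) has_sum H1) UNIV" .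
  have Q: "((\<lambda>(m, n). if m = 0 \<and> n = 0 then - 1 / 4 else 0) has_sum (- 1 / 4 :: complex)) (UNIV :: (int \<times> int) set)"
    by (rule has_sum_finite_neutralI[of "{(0, 0)}"]) (auto split: if_splits)
  have "((\<lambda>(m, n). if m + n = 0 then r m else 0) has_sum R) (UNIV :: (int \<times> int) set) \<longleftrightarrow>
        ((\<lambda>(m, n). if m + n = 0 then r m else 0) has_sum R) (range (\<lambda>m. (m, - m)))"
    by (rule has_sum_cong_neutral) (auto simp: image_iff eq_neg_iff_add_eq_0 add.commute)
  also have "\<dots> \<longleftrightarrow> (r has_sum R) UNIV"
    by (subst has_sum_reindex) (auto simp: inj_on_def o_def)
  finally have Rsum: "((\<lambda>(m, n). if m + n = 0 then r m else 0) has_sum R) UNIV"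
    using r by simp
  have eq: "(\<lambda>(m, n). if m + n = 0 then r m else 0) = (\<lambda>p.
      (case p of (m, n) \<Rightarrow> f m * (?s n - ?s (m + n))) + (case p of (m, n) \<Rightarrow> g n * (?s m - ?s (m + n))) +
      (case p of (m, n) \<Rightarrow> f m * g n) + - (case p of (m, n) \<Rightarrow> h (m + n) * f m) +
      - (case p of (m, n) \<Rightarrow> h (m + n) * g n) + - (case p of (m, n) \<Rightarrow> h (m + n) * (?s m + ?s n)) +
      - (case p of (m, n) \<Rightarrow> if m = 0 \<and> n = 0 then - 1 / 4 else 0))"
  proof (rule ext, clarify)
    fix m n :: int
    have sgn: "?s m * ?s n + 1 / 4 - ?s (m + n) * (?s m + ?s n) = (if m = 0 \<and> n = 0 then 1 / 4 else 0)"
      by (auto simp: half_sgn_def sgn_if)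
    have "(if m + n = 0 then r m else 0) = (?s m + f m) * (?s n + g n) + 1 / 4 -
       (?s (m + n) + h (m + n)) * ((?s m + f m) + (?s n + g n))"
      using rel[of m n] by simp
    also have "\<dots> = f m * (?s n - ?s (m + n)) + g n * (?s m - ?s (m + n)) + f m * g n +
      - (h (m + n) * f m) + - (h (m + n) * g n) + - (h (m + n) * (?s m + ?s n)) +
      (?s m * ?s n + 1 / 4 - ?s (m + n) * (?s m + ?s n))"
      by (simp add: algebra_simps)
    finally show "(if m + n = 0 then r m else 0) = f m * (?s n - ?s (m + n)) + g n * (?s m - ?s (m + n)) + f m * g n +
      - (h (m + n) * f m) + - (h (m + n) * g n) + - (h (m + n) * (?s m + ?s n)) +
      - (if m = 0 \<and> n = 0 then - 1 / 4 else 0)"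
      by (simp add: sgn)
  qed
  have "((\<lambda>(m, n). if m + n = 0 then r m else 0) has_sum
      (- F1 + - G1 + F * G + - (H * F) + - (H * G) + - H1 + - (- 1 / 4))) UNIV"
    unfolding eq by (intro has_sum_add has_sum_uminusI A B C D D' E Q)
  from has_sum_unique[OF this Rsum] show ?thesis
    by (simp add: algebra_simps)
qed

section \<open>The hyperbolic cotangent and its lattice sums\<close>

text \<open>
This is \<open>- coth (u / 2) / 2\<close>. The normalisation makes it tend to \<open>1/2\<close> for \<open>Re u \<longlongrightarrow> - \<infinity>\<close>, which is the
direction of \<open>v + m w\<close> for \<open>m \<longlongrightarrow> \<infinity>\<close> when \<open>Re w < 0\<close>. At its poles it takes the value \<open>0\<close>.
\<close>

definition half_coth :: "complex \<Rightarrow> complex" where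
  "half_coth u = (1 + exp u) / (2 * (1 - exp u))"

lemma half_coth_minus: "half_coth (- u) = - half_coth u"
  unfolding half_coth_def exp_minus
  by (cases "exp u = 1") (auto simp: divide_simps, auto simp: algebra_simps)

lemma half_coth_add_two_pi_i: "half_coth (u + 2 * of_real pi * \<i>) = half_coth u"
  by (simp add: half_coth_def exp_add exp_two_pi_i' mult.commute)

lemma half_coth_add:
  assumes "exp a \<noteq> 1" "exp b \<noteq> 1" "exp (a + b) \<noteq> 1"
  shows "half_coth a * half_coth b + 1 / 4 = half_coth (a + b) * (half_coth a + half_coth b)"
proof -
  have "1 - exp a \<noteq> 0" "1 - exp b \<noteq> 0" "1 - exp a * exp b \<noteq> 0"
    using assms by (auto simp: exp_add)
  thus ?thesis
    unfolding half_coth_def exp_add by (simp add: divide_simps) algebra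
qed

text \<open>
The derivative of \<open>half_coth\<close>, equal to \<open>exp u / (1 - exp u)\<^sup>2 = 1 / (4 sinh\<^sup>2 (u / 2))\<close>; the form
chosen here is the Riccati equation of \<open>half_coth\<close>.
\<close>

definition cosech_sq :: "complex \<Rightarrow> complex" where
  "cosech_sq u = half_coth u ^ 2 - 1 / 4"

lemma has_field_derivative_half_coth:
  assumes "exp u \<noteq> 1"
  shows "(half_coth has_field_derivative cosech_sq u) (at u)"
proof -
  have nz: "1 - exp u \<noteq> 0" using assms by auto
  have "((\<lambda>u. (1 + exp u) / (2 * (1 - exp u))) has_field_derivative
      (exp u * (2 * (1 - exp u)) - (1 + exp u) * (2 * (- exp u))) / (2 * (1 - exp u) * (2 * (1 - exp u)))) (at u)"
    using nz by (auto intro!: derivative_eq_intros)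
  also have "(exp u * (2 * (1 - exp u)) - (1 + exp u) * (2 * (- exp u))) / (2 * (1 - exp u) * (2 * (1 - exp u))) = cosech_sq u"
    unfolding cosech_sq_def half_coth_def using nz by (simp add: divide_simps) algebra
  finally show ?thesis
    by (simp add: half_coth_def[abs_def])
qed

lemma has_field_derivative_cosech_sq:
  assumes "exp u \<noteq> 1"
  shows "(cosech_sq has_field_derivative 2 * half_coth u * cosech_sq u) (at u)"
  unfolding cosech_sq_def[abs_def]
  by (auto intro!: derivative_eq_intros has_field_derivative_half_coth[OF assms] simp: cosech_sq_def)

definition half_coth_reg :: "int \<Rightarrow> complex \<Rightarrow> complex" where
  "half_coth_reg m u = half_coth u - half_sgn m"

lemma half_coth_reg_minus: "half_coth_reg (- m) (- u) = - half_coth_reg m u"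
  by (simp add: half_coth_reg_def half_coth_minus)

lemma half_coth_reg_pos:
  assumes "m > 0" "exp u \<noteq> 1"
  shows "half_coth_reg m u = exp u / (1 - exp u)"
proof -
  have "1 - exp u \<noteq> 0" using assms by auto
  thus ?thesis
    using assms by (simp add: half_coth_reg_def half_coth_def half_sgn_def sgn_if divide_simps)
qed

lemma norm_half_coth_reg_le:
  assumes AW: "A < W" and v: "\<bar>Re v\<bar> \<le> A" and w: "Re w \<le> - W" and "m \<noteq> 0"
  shows "norm (half_coth_reg m (v + of_int m * w)) \<le> exp A / (1 - exp (A - W)) * exp (- W) ^ nat \<bar>m\<bar>"
proof -
  have pos: "norm (half_coth_reg m (v + of_int m * w)) \<le> exp A / (1 - exp (A - W)) * exp (- W) ^ nat \<bar>m\<bar>"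
    if m: "m > 0" and v: "\<bar>Re v\<bar> \<le> A" for m v
  proof -
    define u where "u = v + of_int m * w"
    have "of_int m * Re w \<le> of_int m * (- W)"
      using m w by (intro mult_left_mono) auto
    moreover have "of_int m * Re w \<le> 1 * (- W)"
    proof -
      have "(of_int m - 1) * W \<ge> 0" using m AW v by (intro mult_nonneg_nonneg) auto
      thus ?thesis using calculation by (simp add: algebra_simps)
    qed
    ultimately have u1: "Re u \<le> A - of_int m * W" and u2: "Re u \<le> A - W"
      using v by (auto simp: u_def)
    have ne: "norm (exp u) \<le> exp (A - W)" "exp (A - W) < 1"
      using u2 AW by auto
    have ge: "norm (1 - exp u) \<ge> 1 - exp (A - W)"
      using ne(1) norm_triangle_ineq2[of 1 "exp u"] unfolding norm_one by linarith
    have ne1: "exp u \<noteq> 1"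
    proof
      assume "exp u = 1"
      show False using ne unfolding \<open>exp u = 1\<close> norm_one by linarith
    qed
    have "norm (half_coth_reg m u) = norm (exp u) / norm (1 - exp u)"
      using half_coth_reg_pos[OF m ne1] by (simp add: norm_divide)
    also have "\<dots> \<le> exp (A - of_int m * W) / (1 - exp (A - W))"
      using ge ne u1 by (intro frac_le) auto
    also have "exp (A - of_int m * W) = exp A * exp (- W) ^ nat \<bar>m\<bar>"
      using m by (simp add: exp_diff exp_minus power_inverse divide_inverse exp_of_nat_mult[symmetric])
    finally show ?thesis by (simp add: u_def)
  qed
  show ?thesis
  proof (cases "m > 0")
    case True
    thus ?thesis using pos v by blast
  next
    case False
    hence m: "- m > 0" using \<open>m \<noteq> 0\<close> by simp
    have "half_coth_reg m (v + of_int m * w) = - half_coth_reg (- m) (- v + of_int (- m) * w)"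
      using half_coth_reg_minus[of "- m" "- v + of_int (- m) * w"] by (simp add: add.commute)
    hence "norm (half_coth_reg m (v + of_int m * w)) = norm (half_coth_reg (- m) (- v + of_int (- m) * w))"
      by simp
    also have "\<dots> \<le> exp A / (1 - exp (A - W)) * exp (- W) ^ nat \<bar>- m\<bar>"
      using v by (intro pos m) auto
    finally show ?thesis by simp
  qed
qed

text \<open>
With \<open>f\<close> the regularised cotangent, the Riccati equation reads \<open>cosech_sq = f (f \<plusminus> 1)\<close>, so the bound
on \<open>f\<close> carries over.
\<close>

lemma norm_cosech_sq_le:
  assumes AW: "A < W" and v: "\<bar>Re v\<bar> \<le> A" and w: "Re w \<le> - W" and m: "m \<noteq> 0"
  shows "norm (cosech_sq (v + of_int m * w)) \<le>
      exp A / (1 - exp (A - W)) * (exp A / (1 - exp (A - W)) + 1) * exp (- W) ^ nat \<bar>m\<bar>"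
proof -
  define C where "C = exp A / (1 - exp (A - W))"
  define f where "f = half_coth_reg m (v + of_int m * w)"
  have C: "C \<ge> 0" using AW by (simp add: C_def)
  have W: "exp (- W) ^ nat \<bar>m\<bar> \<le> 1" using AW v by (intro power_le_one) auto
  have f: "norm f \<le> C * exp (- W) ^ nat \<bar>m\<bar>"
    unfolding f_def C_def by (rule norm_half_coth_reg_le) fact+
  have f': "norm f \<le> C" using f W C mult_left_le[of "exp (- W) ^ nat \<bar>m\<bar>" C] by linarith
  have "cosech_sq (v + of_int m * w) = f * (f + of_int (sgn m))"
    using m by (auto simp: cosech_sq_def f_def half_coth_reg_def half_sgn_def sgn_if power2_eq_square algebra_simps)
  also have "norm \<dots> \<le> norm f * (norm f + 1)"
    unfolding norm_mult using m norm_triangle_ineq[of f "of_int (sgn m)"]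
    by (intro mult_left_mono) (auto simp: sgn_if)
  also have "\<dots> \<le> C * exp (- W) ^ nat \<bar>m\<bar> * (C + 1)"
    using f f' C by (intro mult_mono) auto
  finally show ?thesis by (simp add: C_def mult_ac)
qed

lemma summable_on_int_geometric:
  fixes r :: real
  assumes "0 \<le> r" "r < 1"
  shows "(\<lambda>m::int. (1 + \<bar>of_int m\<bar>) * r ^ nat \<bar>m\<bar>) summable_on UNIV"
proof -
  have "summable (\<lambda>n. of_nat (Suc n) * r ^ n)"
    using geometric_deriv_sums[of r] assms by (auto simp: sums_iff)
  hence "(\<lambda>n::nat. (1 + real n) * r ^ n) summable_on UNIV"
    using assms by (intro norm_summable_imp_summable_on) (simp add: algebra_simps)
  hence 1: "((\<lambda>m::int. (1 + \<bar>of_int m\<bar>) * r ^ nat \<bar>m\<bar>) \<circ> int) summable_on UNIV"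
       and 2: "((\<lambda>m::int. (1 + \<bar>of_int m\<bar>) * r ^ nat \<bar>m\<bar>) \<circ> (\<lambda>n. - int n)) summable_on UNIV"
    by (auto simp: o_def)
  have "(\<lambda>m::int. (1 + \<bar>of_int m\<bar>) * r ^ nat \<bar>m\<bar>) summable_on (range int \<union> range (\<lambda>n. - int n))"
    using 1 2 by (intro summable_on_union) (subst summable_on_reindex; simp add: inj_on_def)+
  also have "range int \<union> range (\<lambda>n. - int n) = UNIV"
    by (auto simp: image_iff) (metis int_cases2)
  finally show ?thesis .
qed

text \<open>
Weierstrass' theorem for unordered sums: only the terms need a summable majorant, since uniform limits
of holomorphic functions may be differentiated termwise.
\<close>

lemma has_field_derivative_infsum:
  fixes f :: "'a \<Rightarrow> complex \<Rightarrow> complex"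
  assumes "0 < R" and d: "\<And>i x. i \<in> I \<Longrightarrow> x \<in> cball z R \<Longrightarrow> (f i has_field_derivative f' i x) (at x)"
    and bound: "\<And>i x. i \<in> I \<Longrightarrow> x \<in> cball z R \<Longrightarrow> norm (f i x) \<le> M i" and "M summable_on I"
  shows "((\<lambda>x. \<Sum>\<^sub>\<infinity>i\<in>I. f i x) has_field_derivative (\<Sum>\<^sub>\<infinity>i\<in>I. f' i z)) (at z)"
    and "(\<lambda>i. f' i z) summable_on I"
proof -
  have ul: "uniform_limit (cball z R) (\<lambda>X y. \<Sum>i\<in>X. f i y) (\<lambda>y. \<Sum>\<^sub>\<infinity>i\<in>I. f i y) (finite_subsets_at_top I)"
    using bound \<open>M summable_on I\<close> by (rule Weierstrass_m_test_general)
  have ev: "\<forall>\<^sub>F X in finite_subsets_at_top I. continuous_on (cball z R) (\<lambda>y. \<Sum>i\<in>X. f i y) \<and>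
      (\<forall>w\<in>ball z R. ((\<lambda>y. \<Sum>i\<in>X. f i y) has_field_derivative (\<Sum>i\<in>X. f' i w)) (at w))"
  proof (rule eventually_finite_subsets_at_top_weakI)
    fix X assume "finite X" "X \<subseteq> I"
    have "((\<lambda>y. \<Sum>i\<in>X. f i y) has_field_derivative (\<Sum>i\<in>X. f' i w)) (at w)" if "w \<in> cball z R" for w
      using that \<open>X \<subseteq> I\<close> by (intro DERIV_sum d) auto
    thus "continuous_on (cball z R) (\<lambda>y. \<Sum>i\<in>X. f i y) \<and>
      (\<forall>w\<in>ball z R. ((\<lambda>y. \<Sum>i\<in>X. f i y) has_field_derivative (\<Sum>i\<in>X. f' i w)) (at w))"
      by (auto intro!: continuous_at_imp_continuous_on DERIV_isCont)
  qed
  obtain g' where g': "\<And>w. w \<in> ball z R \<Longrightarrow>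
      ((\<lambda>y. \<Sum>\<^sub>\<infinity>i\<in>I. f i y) has_field_derivative g' w) (at w) \<and>
      ((\<lambda>X. \<Sum>i\<in>X. f' i w) \<longlongrightarrow> g' w) (finite_subsets_at_top I)"
    by (rule has_complex_derivative_uniform_limit[OF ev ul _ \<open>0 < R\<close>]) (auto simp: finite_subsets_at_top_neq_bot)
  have z: "z \<in> ball z R" using \<open>0 < R\<close> by simp
  have "((\<lambda>i. f' i z) has_sum g' z) I"
    using g'[OF z] by (simp add: has_sum_def)
  thus "((\<lambda>x. \<Sum>\<^sub>\<infinity>i\<in>I. f i x) has_field_derivative (\<Sum>\<^sub>\<infinity>i\<in>I. f' i z)) (at z)" "(\<lambda>i. f' i z) summable_on I"
    using g'[OF z] by (auto simp: has_sum_iff)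
qed

text \<open>
In the strip \<open>\<bar>Re v\<bar> < - Re w\<close> only the term \<open>m = 0\<close> of a lattice sum has poles, and these are removed.
What remains contains the multiples of \<open>\<pi> \<i> / 3\<close> outside \<open>2 \<pi> \<i> \<int>\<close> for every \<open>w\<close> with \<open>Re w < 0\<close>.
\<close>

definition punctured_strip :: "complex \<Rightarrow> complex set" where
  "punctured_strip w = {v. \<bar>Re v\<bar> < - Re w \<and> exp v \<noteq> 1}"

lemma exp_shift_neq_1:
  assumes "\<bar>Re v\<bar> < - Re w" "m \<noteq> 0"
  shows "exp (v + of_int m * w) \<noteq> 1"
proof
  assume "exp (v + of_int m * w) = 1"
  hence "norm (exp (v + of_int m * w)) = 1" by simp
  hence "Re v = - (of_int m * Re w)" by simp
  hence "\<bar>Re v\<bar> = \<bar>of_int m\<bar> * \<bar>Re w\<bar>" by (simp add: abs_mult)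
  moreover have "1 * \<bar>Re w\<bar> \<le> \<bar>of_int m\<bar> * \<bar>Re w\<bar>"
    using \<open>m \<noteq> 0\<close> by (intro mult_right_mono) auto
  ultimately show False using assms(1) by linarith
qed

lemma exp_shift_neq_1':
  assumes "v \<in> punctured_strip w"
  shows "exp (v + of_int m * w) \<noteq> 1"
  using assms exp_shift_neq_1[of v w m] by (cases "m = 0") (auto simp: punctured_strip_def)

lemma open_punctured_strip: "open (punctured_strip w)"
proof -
  have "open {v. \<bar>Re v\<bar> < - Re w}" "open {v::complex. exp v \<noteq> 1}"
    by (intro open_Collect_less open_Collect_neq continuous_intros)+
  thus ?thesis
    unfolding punctured_strip_def Collect_conj_eq by (rule open_Int)
qed

lemma open_punctured_strip_pairs: "open {x. v + s * x \<in> punctured_strip (w + t * x)}"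
proof -
  have "{x. v + s * x \<in> punctured_strip (w + t * x)} =
      {x. \<bar>Re (v + s * x)\<bar> < - Re (w + t * x)} \<inter> {x. exp (v + s * x) \<noteq> 1}"
    by (auto simp: punctured_strip_def)
  also have "open \<dots>"
    by (intro open_Int open_Collect_less open_Collect_neq continuous_intros)
  finally show ?thesis .
qed

text \<open>
Exponential decay of the terms \<open>m \<noteq> 0\<close> of a lattice sum, locally uniformly in both variables: this one
condition serves for summation and for differentiation in \<open>v\<close> and in \<open>w\<close>.
\<close>

definition lattice_decay :: "(int \<Rightarrow> complex \<Rightarrow> complex) \<Rightarrow> bool" where
  "lattice_decay \<phi> \<longleftrightarrow> (\<forall>A W. A < W \<longrightarrow> (\<exists>C\<ge>0. \<forall>m v w. m \<noteq> 0 \<longrightarrow> \<bar>Re v\<bar> \<le> A \<longrightarrow> Re w \<le> - W \<longrightarrow>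
     norm (\<phi> m (v + of_int m * w)) \<le> C * exp (- W) ^ nat \<bar>m\<bar>))"

lemma lattice_decayD:
  assumes "lattice_decay \<phi>" "A < W"
  obtains C where "C \<ge> 0" "\<And>m v w. m \<noteq> 0 \<Longrightarrow> \<bar>Re v\<bar> \<le> A \<Longrightarrow> Re w \<le> - W \<Longrightarrow>
      norm (\<phi> m (v + of_int m * w)) \<le> C * exp (- W) ^ nat \<bar>m\<bar>"
  using assms unfolding lattice_decay_def by metis

lemma lattice_decay_half_coth_reg: "lattice_decay half_coth_reg"
  unfolding lattice_decay_def
proof safe
  fix A W :: real assume "A < W"
  thus "\<exists>C\<ge>0. \<forall>m v w. m \<noteq> 0 \<longrightarrow> \<bar>Re v\<bar> \<le> A \<longrightarrow> Re w \<le> - W \<longrightarrow>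
     norm (half_coth_reg m (v + of_int m * w)) \<le> C * exp (- W) ^ nat \<bar>m\<bar>"
    using norm_half_coth_reg_le by (intro exI[of _ "exp A / (1 - exp (A - W))"]) auto
qed

lemma lattice_decay_cosech_sq: "lattice_decay (\<lambda>_. cosech_sq)"
  unfolding lattice_decay_def
proof safe
  fix A W :: real assume "A < W"
  thus "\<exists>C\<ge>0. \<forall>m v w. m \<noteq> 0 \<longrightarrow> \<bar>Re v\<bar> \<le> A \<longrightarrow> Re w \<le> - W \<longrightarrow>
     norm (cosech_sq (v + of_int m * w)) \<le> C * exp (- W) ^ nat \<bar>m\<bar>"
    using norm_cosech_sq_le
    by (intro exI[of _ "exp A / (1 - exp (A - W)) * (exp A / (1 - exp (A - W)) + 1)"]) auto
qed

lemma abs_summable_lattice: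
  assumes "lattice_decay \<phi>" and v: "\<bar>Re v\<bar> < - Re w"
    and c: "\<And>m. norm (c m) \<le> 1 + \<bar>of_int m\<bar>"
  shows "(\<lambda>m. norm (c m * \<phi> m (v + of_int m * w))) summable_on UNIV"
proof -
  obtain C where C: "C \<ge> 0" "\<And>m. m \<noteq> 0 \<Longrightarrow>
      norm (\<phi> m (v + of_int m * w)) \<le> C * exp (Re w) ^ nat \<bar>m\<bar>"
    by (rule lattice_decayD[OF assms(1) v]) auto
  define B where "B = norm (c 0 * \<phi> 0 v)"
  define M where "M m = (if m = 0 then B else 0) + C * ((1 + \<bar>of_int m\<bar>) * exp (Re w) ^ nat \<bar>m\<bar>)" for m :: int
  have "norm (c m * \<phi> m (v + of_int m * w)) \<le> M m" for m
  proof (cases "m = 0")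
    case True
    thus ?thesis using C(1) by (simp add: M_def B_def)
  next
    case False
    hence "norm (c m * \<phi> m (v + of_int m * w)) \<le> (1 + \<bar>of_int m\<bar>) * (C * exp (Re w) ^ nat \<bar>m\<bar>)"
      unfolding norm_mult using c[of m] C(2)[of m] by (intro mult_mono) auto
    thus ?thesis using False by (simp add: M_def mult_ac)
  qed
  moreover have "(\<lambda>m. if m = 0 then B else 0) summable_on (UNIV :: int set)"
    by (rule finite_nonzero_values_imp_summable_on) (auto intro: finite_subset[of _ "{0}"])
  hence "M summable_on UNIV"
    unfolding M_def[abs_def] using v
    by (intro summable_on_add summable_on_cmult_right summable_on_int_geometric) auto
  ultimately show ?thesis
    by (intro Infinite_Sum.abs_summable_on_comparison_test'[of M]) auto
qed

text \<open>
The derivative along the line \<open>x \<mapsto> (v + s x, w + t x)\<close>, so that the directions \<open>(1, 0)\<close> and \<open>(0, 1)\<close>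
give both partial derivatives at once. On a small disc the term \<open>m = 0\<close> is bounded by compactness,
the others by \<open>lattice_decay\<close>.
\<close>

lemma has_field_derivative_lattice_sum:
  fixes \<phi> \<phi>' :: "int \<Rightarrow> complex \<Rightarrow> complex" and c :: "int \<Rightarrow> complex"
  assumes deriv: "\<And>m u. exp u \<noteq> 1 \<Longrightarrow> (\<phi> m has_field_derivative \<phi>' m u) (at u)"
    and decay: "lattice_decay \<phi>"
    and v: "v \<in> punctured_strip w"
    and c: "\<And>m. norm (c m) \<le> 1 + \<bar>of_int m\<bar>"
  shows "((\<lambda>x. \<Sum>\<^sub>\<infinity>m. c m * \<phi> m (v + s * x + of_int m * (w + t * x))) has_field_derivative
           (\<Sum>\<^sub>\<infinity>m. c m * ((s + of_int m * t) * \<phi>' m (v + of_int m * w)))) (at 0)"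
proof -
  have "0 \<in> {x. v + s * x \<in> punctured_strip (w + t * x)}" using v by simp
  then obtain R where R: "R > 0" "cball 0 R \<subseteq> {x. v + s * x \<in> punctured_strip (w + t * x)}"
    using open_contains_cball open_punctured_strip_pairs by blast
  obtain \<delta> where \<delta>: "\<delta> > 0" "\<And>x. x \<in> cball 0 \<delta> \<Longrightarrow> x \<in> cball 0 R \<and>
      \<bar>Re (v + s * x)\<bar> \<le> (\<bar>Re v\<bar> + (\<bar>Re v\<bar> - Re w) / 2) / 2 \<and> Re (w + t * x) \<le> - ((\<bar>Re v\<bar> - Re w) / 2)"
  proof -
    let ?S = "{x. \<bar>Re (v + s * x)\<bar> < (\<bar>Re v\<bar> + (\<bar>Re v\<bar> - Re w) / 2) / 2} \<inter>
        {x. Re (w + t * x) < - ((\<bar>Re v\<bar> - Re w) / 2)} \<inter> ball 0 R"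
    have "open ?S"
      by (intro open_Int open_Collect_less continuous_intros open_ball)
    moreover have "0 \<in> ?S" using v R(1) by (auto simp: punctured_strip_def field_simps)
    ultimately obtain \<delta> where "\<delta> > 0" "cball 0 \<delta> \<subseteq> ?S"
      using open_contains_cball by blast
    thus ?thesis by (intro that[of \<delta>]) (auto dest!: subsetD)
  qed
  \<comment> \<open>\<open>W\<close> is the midpoint of \<open>\<bar>Re v\<bar>\<close> and \<open>- Re w\<close>, and \<open>A\<close> that of \<open>\<bar>Re v\<bar>\<close> and \<open>W\<close>.\<close>
  define W where "W = (\<bar>Re v\<bar> - Re w) / 2"
  define A where "A = (\<bar>Re v\<bar> + W) / 2"
  have AW: "A < W" "0 < W" using v by (auto simp: A_def W_def punctured_strip_def field_simps)
  obtain C where C: "C \<ge> 0" "\<And>m v w. m \<noteq> 0 \<Longrightarrow> \<bar>Re v\<bar> \<le> A \<Longrightarrow> Re w \<le> - W \<Longrightarrow>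
          norm (\<phi> m (v + of_int m * w)) \<le> C * exp (- W) ^ nat \<bar>m\<bar>"
    using lattice_decayD[OF decay AW(1)] by blast
  define F where "F m x = c m * \<phi> m (v + s * x + of_int m * (w + t * x))" for m x
  define F' where "F' m x = c m * ((s + of_int m * t) * \<phi>' m (v + s * x + of_int m * (w + t * x)))" for m x
  have dF: "(F m has_field_derivative F' m x) (at x)" if "x \<in> cball 0 \<delta>" for m x
  proof -
    have "exp (v + s * x + of_int m * (w + t * x)) \<noteq> 1"
      using exp_shift_neq_1'[of "v + s * x" "w + t * x" m] R(2) \<delta>(2)[OF that] by blast
    note * = deriv[OF this, of m]
    have "((\<lambda>x. v + s * x + of_int m * (w + t * x)) has_field_derivative s + of_int m * t) (at x)"
      by (auto intro!: derivative_eq_intros)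
    from DERIV_cmult[OF DERIV_chain2[where f = "\<phi> m" and g = "\<lambda>x. v + s * x + of_int m * (w + t * x)", OF * this], of "c m"]
    show ?thesis
      unfolding F_def[abs_def] F'_def by (simp add: mult_ac)
  qed
  have "continuous_on (cball 0 \<delta>) (F 0)"
    using dF by (auto intro!: continuous_at_imp_continuous_on DERIV_isCont)
  hence "bounded (F 0 ` cball 0 \<delta>)"
    using compact_continuous_image compact_cball compact_imp_bounded by blast
  then obtain B where "\<forall>y\<in>F 0 ` cball 0 \<delta>. norm y \<le> B"
    unfolding bounded_iff by blast
  hence B: "\<And>x. x \<in> cball 0 \<delta> \<Longrightarrow> norm (F 0 x) \<le> B"
    by blast
  define M where "M m = (if m = 0 then B else 0) + C * ((1 + \<bar>of_int m\<bar>) * exp (- W) ^ nat \<bar>m\<bar>)" for m :: int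
  have bd: "norm (F m x) \<le> M m" if x: "x \<in> cball 0 \<delta>" for m x
  proof (cases "m = 0")
    case True
    thus ?thesis using B[OF x] C(1) by (simp add: M_def)
  next
    case False
    have "norm (\<phi> m (v + s * x + of_int m * (w + t * x))) \<le> C * exp (- W) ^ nat \<bar>m\<bar>"
      using \<delta>(2)[OF x] False by (intro C) (auto simp: A_def W_def)
    hence "norm (F m x) \<le> (1 + \<bar>of_int m\<bar>) * (C * exp (- W) ^ nat \<bar>m\<bar>)"
      unfolding F_def norm_mult using c[of m] by (intro mult_mono) auto
    thus ?thesis using False by (simp add: M_def mult_ac)
  qed
  have "(\<lambda>m. if m = 0 then B else 0) summable_on (UNIV :: int set)"
    by (rule finite_nonzero_values_imp_summable_on) (auto intro: finite_subset[of _ "{0}"])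
  hence "M summable_on UNIV"
    unfolding M_def[abs_def] using AW
    by (intro summable_on_add summable_on_cmult_right summable_on_int_geometric) auto
  from has_field_derivative_infsum(1)[where z = 0 and f = F and f' = F', OF \<delta>(1) dF bd this]
  show ?thesis
    unfolding F_def F'_def by simp
qed

section \<open>The quasi-periodic zeta function and its addition theorem\<close>

text \<open>
Up to sign and a term linear in \<open>v\<close>, the Weierstrass zeta function of the lattice \<open>2 \<pi> \<i> \<int> + w \<int>\<close>.
\<close>

definition qzeta :: "complex \<Rightarrow> complex \<Rightarrow> complex" where
  "qzeta v w = (\<Sum>\<^sub>\<infinity>m. half_coth_reg m (v + of_int m * w))"

text \<open>
With \<open>z = exp v\<close>, this is the derivative with respect to \<open>w\<close> of
\<open>log (\<Prod>\<^sub>m (1 - z q\<^sup>m) (1 - q\<^sup>m / z))\<close>, the product being over \<open>m \<ge> 1\<close>. The term \<open>m = 0\<close> carries the weight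
\<open>0\<close>, so \<open>v = 0\<close> is a legitimate argument.
\<close>

definition qheat :: "complex \<Rightarrow> complex \<Rightarrow> complex" where
  "qheat v w = - (\<Sum>\<^sub>\<infinity>m. of_int m * half_coth_reg m (v + of_int m * w))"

text \<open>
For \<open>k = 0\<close> the Weierstrass \<open>\<wp>\<close>-function of the lattice up to an additive constant, namely the
\<open>v\<close>-derivative of \<open>qzeta\<close>; for \<open>k = 1\<close> the \<open>w\<close>-derivative of \<open>qzeta\<close>, which is minus the \<open>v\<close>-derivative
of \<open>qheat\<close>.
\<close>

definition qwp :: "nat \<Rightarrow> complex \<Rightarrow> complex \<Rightarrow> complex" where
  "qwp k v w = (\<Sum>\<^sub>\<infinity>m. of_int m ^ k * cosech_sq (v + of_int m * w))"

text \<open>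
The common value of \<open>\<partial>/\<partial>w\<close> of \<open>qwp 0\<close> and \<open>\<partial>/\<partial>v\<close> of \<open>qwp 1\<close>.
\<close>

definition qwp_mixed :: "complex \<Rightarrow> complex \<Rightarrow> complex" where
  "qwp_mixed v w = (\<Sum>\<^sub>\<infinity>m. of_int m * (2 * half_coth (v + of_int m * w) * cosech_sq (v + of_int m * w)))"

lemma has_field_derivative_half_coth_reg:
  "exp u \<noteq> 1 \<Longrightarrow> (half_coth_reg m has_field_derivative cosech_sq u) (at u)"
  unfolding half_coth_reg_def[abs_def]
  by (auto intro!: derivative_eq_intros has_field_derivative_half_coth)

lemma lattice_sum_deriv_v:
  assumes "\<And>m u. exp u \<noteq> 1 \<Longrightarrow> (\<phi> m has_field_derivative \<phi>' m u) (at u)" "lattice_decay \<phi>"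
    and "v \<in> punctured_strip w" and "\<And>m. norm (c m) \<le> 1 + \<bar>of_int m\<bar>"
  shows "((\<lambda>v. \<Sum>\<^sub>\<infinity>m. c m * \<phi> m (v + of_int m * w)) has_field_derivative
           (\<Sum>\<^sub>\<infinity>m. c m * \<phi>' m (v + of_int m * w))) (at v)"
  using has_field_derivative_lattice_sum[where \<phi> = \<phi> and \<phi>' = \<phi>' and c = c and s = 1 and t = 0,
      OF _ assms(2-4)] assms(1)
    DERIV_shift[of "\<lambda>v. \<Sum>\<^sub>\<infinity>m. c m * \<phi> m (v + of_int m * w)"
      "\<Sum>\<^sub>\<infinity>m. c m * \<phi>' m (v + of_int m * w)" 0 v]
  by (simp add: mult_1 mult_zero_left mult_zero_right add_0_right add_0_left add.commute[of _ v])

lemma lattice_sum_deriv_w: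
  assumes "\<And>m u. exp u \<noteq> 1 \<Longrightarrow> (\<phi> m has_field_derivative \<phi>' m u) (at u)" "lattice_decay \<phi>"
    and "v \<in> punctured_strip w" and "\<And>m. norm (c m) \<le> 1 + \<bar>of_int m\<bar>"
  shows "((\<lambda>w. \<Sum>\<^sub>\<infinity>m. c m * \<phi> m (v + of_int m * w)) has_field_derivative
           (\<Sum>\<^sub>\<infinity>m. c m * (of_int m * \<phi>' m (v + of_int m * w)))) (at w)"
  using has_field_derivative_lattice_sum[where \<phi> = \<phi> and \<phi>' = \<phi>' and c = c and s = 0 and t = 1,
      OF _ assms(2-4)] assms(1)
    DERIV_shift[of "\<lambda>w. \<Sum>\<^sub>\<infinity>m. c m * \<phi> m (v + of_int m * w)"
      "\<Sum>\<^sub>\<infinity>m. c m * (of_int m * \<phi>' m (v + of_int m * w))" 0 w]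
  by (simp add: mult_1 mult_1_right mult_zero_left mult_zero_right add_0_right add_0_left add.commute[of _ w])

lemma qzeta_deriv_v:
  assumes "v \<in> punctured_strip w"
  shows "((\<lambda>v. qzeta v w) has_field_derivative qwp 0 v w) (at v)"
  using lattice_sum_deriv_v[where \<phi> = "half_coth_reg" and \<phi>' = "\<lambda>_. cosech_sq" and c = "\<lambda>_. 1",
      OF has_field_derivative_half_coth_reg lattice_decay_half_coth_reg assms]
  by (simp add: qzeta_def qwp_def)

lemma qzeta_deriv_w:
  assumes "v \<in> punctured_strip w"
  shows "((\<lambda>w. qzeta v w) has_field_derivative qwp 1 v w) (at w)"
  using lattice_sum_deriv_w[where \<phi> = "half_coth_reg" and \<phi>' = "\<lambda>_. cosech_sq" and c = "\<lambda>_. 1",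
      OF has_field_derivative_half_coth_reg lattice_decay_half_coth_reg assms]
  by (simp add: qzeta_def qwp_def)

lemma qheat_deriv_v:
  assumes "v \<in> punctured_strip w"
  shows "((\<lambda>v. qheat v w) has_field_derivative - qwp 1 v w) (at v)"
  using DERIV_minus[OF lattice_sum_deriv_v[where \<phi> = half_coth_reg and \<phi>' = "\<lambda>_. cosech_sq" and c = of_int,
      OF has_field_derivative_half_coth_reg lattice_decay_half_coth_reg assms]]
  by (simp add: qheat_def qwp_def)

lemma qwp0_deriv_w:
  assumes "v \<in> punctured_strip w"
  shows "((\<lambda>w. qwp 0 v w) has_field_derivative qwp_mixed v w) (at w)"
  using lattice_sum_deriv_w[where \<phi> = "\<lambda>_. cosech_sq" and \<phi>' = "\<lambda>_ u. 2 * half_coth u * cosech_sq u" and c = "\<lambda>_. 1",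
      OF has_field_derivative_cosech_sq lattice_decay_cosech_sq assms]
  by (simp add: qwp_def qwp_mixed_def)

lemma qwp1_deriv_v:
  assumes "v \<in> punctured_strip w"
  shows "((\<lambda>v. qwp 1 v w) has_field_derivative qwp_mixed v w) (at v)"
  using lattice_sum_deriv_v[where \<phi> = "\<lambda>_. cosech_sq" and \<phi>' = "\<lambda>_ u. 2 * half_coth u * cosech_sq u" and c = of_int,
      OF has_field_derivative_cosech_sq lattice_decay_cosech_sq assms]
  by (simp add: qwp_def qwp_mixed_def)

lemma half_coth_reg_summable:
  assumes "\<bar>Re v\<bar> < - Re w"
  shows "(\<lambda>m. norm (half_coth_reg m (v + of_int m * w))) summable_on UNIV"
    and "(\<lambda>m. norm (of_int m * half_coth_reg m (v + of_int m * w))) summable_on UNIV"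
    and "((\<lambda>m. half_coth_reg m (v + of_int m * w)) has_sum qzeta v w) UNIV"
    and "((\<lambda>m. of_int m * half_coth_reg m (v + of_int m * w)) has_sum - qheat v w) UNIV"
proof -
  show 1: "(\<lambda>m. norm (half_coth_reg m (v + of_int m * w))) summable_on UNIV"
    using abs_summable_lattice[OF lattice_decay_half_coth_reg assms, of "\<lambda>_. 1"] by simp
  show 2: "(\<lambda>m. norm (of_int m * half_coth_reg m (v + of_int m * w))) summable_on UNIV"
    by (intro abs_summable_lattice[OF lattice_decay_half_coth_reg assms]) auto
  show "((\<lambda>m. half_coth_reg m (v + of_int m * w)) has_sum qzeta v w) UNIV"
    unfolding qzeta_def by (rule has_sum_infsum[OF abs_summable_summable[OF 1]])
  show "((\<lambda>m. of_int m * half_coth_reg m (v + of_int m * w)) has_sum - qheat v w) UNIV"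
    unfolding qheat_def minus_minus by (rule has_sum_infsum[OF abs_summable_summable[OF 2]])
qed

lemma cosech_sq_has_sum:
  assumes "\<bar>Re v\<bar> < - Re w"
  shows "((\<lambda>m. cosech_sq (v + of_int m * w)) has_sum qwp 0 v w) UNIV"
  unfolding qwp_def
  using abs_summable_summable[OF abs_summable_lattice[OF lattice_decay_cosech_sq assms, of "\<lambda>_. 1"]]
  by simp

lemma half_coth_reg_reflect:
  "half_coth_reg (- m) (v + of_int (- m) * w) = - half_coth_reg m (- v + of_int m * w)"
  using half_coth_reg_minus[of m "- v + of_int m * w"] by simp

lemma qzeta_minus: "qzeta (- v) w = - qzeta v w"
proof -
  have "qzeta (- v) w = (\<Sum>\<^sub>\<infinity>m. - half_coth_reg m (v + of_int m * w))"
    unfolding qzeta_def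
  proof (rule infsum_reindex_bij_witness[of _ uminus uminus])
    show "- half_coth_reg (- m) (v + of_int (- m) * w) = half_coth_reg m (- v + of_int m * w)" for m
      by (simp only: half_coth_reg_reflect minus_minus)
  qed auto
  thus ?thesis by (simp only: infsum_uminus qzeta_def)
qed

lemma qheat_minus: "qheat (- v) w = qheat v w"
proof -
  have "(\<Sum>\<^sub>\<infinity>m. of_int m * half_coth_reg m (- v + of_int m * w)) =
        (\<Sum>\<^sub>\<infinity>m. of_int m * half_coth_reg m (v + of_int m * w))"
  proof (rule infsum_reindex_bij_witness[of _ uminus uminus])
    show "of_int (- m) * half_coth_reg (- m) (v + of_int (- m) * w) =
          of_int m * half_coth_reg m (- v + of_int m * w)" for m
      unfolding half_coth_reg_reflect by simp
  qed auto
  thus ?thesis by (simp add: qheat_def)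
qed

lemma half_coth_reg_add_two_pi_i:
  "half_coth_reg m (v + 2 * of_real pi * \<i> + u) = half_coth_reg m (v + u)"
  using half_coth_add_two_pi_i[of "v + u"] by (simp add: half_coth_reg_def add_ac)

lemma qzeta_add_two_pi_i: "qzeta (v + 2 * of_real pi * \<i>) w = qzeta v w"
  by (simp add: qzeta_def half_coth_reg_add_two_pi_i)

lemma qheat_add_two_pi_i: "qheat (v + 2 * of_real pi * \<i>) w = qheat v w"
  by (simp add: qheat_def half_coth_reg_add_two_pi_i)

lemma half_sgn_add_half_coth_reg: "half_sgn m + half_coth_reg m u = half_coth u"
  by (simp add: half_coth_reg_def)

text \<open>
Together with \<open>qzeta_square\<close>, this is the classical identity
\<open>(\<zeta>(a) + \<zeta>(b) + \<zeta>(c))\<^sup>2 = \<wp>(a) + \<wp>(b) + \<wp>(c)\<close> for \<open>a + b + c = 0\<close>. It holds because it is the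
addition theorem of \<open>half_coth\<close> at \<open>a + m w\<close> and \<open>b + n w\<close>, summed over all \<open>m\<close> and \<open>n\<close>.
\<close>

theorem qzeta_add:
  assumes a: "a \<in> punctured_strip w" and b: "b \<in> punctured_strip w" and ab: "a + b \<in> punctured_strip w"
  shows "qzeta a w * qzeta b w - qzeta (a + b) w * (qzeta a w + qzeta b w) +
           qheat a w + qheat b w + qheat (a + b) w = - 1 / 4"
proof -
  let ?f = "\<lambda>v m. half_coth_reg m (v + of_int m * w)"
  have s: "\<bar>Re a\<bar> < - Re w" "\<bar>Re b\<bar> < - Re w" "\<bar>Re (a + b)\<bar> < - Re w"
    using assms by (auto simp: punctured_strip_def)
  have "qzeta a w * qzeta b w - qzeta (a + b) w * (qzeta a w + qzeta b w)
      - (- qheat a w) - (- qheat b w) - (- qheat (a + b) w) + 1 / 4 = 0"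
  proof (rule regularised_convolution[of "?f a" "?f b" "?f (a + b)" "\<lambda>_. 0"])
    fix m n
    have "(a + of_int m * w) + (b + of_int n * w) = a + b + of_int (m + n) * w"
      by (simp add: algebra_simps)
    note add = half_coth_add[OF exp_shift_neq_1'[OF a, of m] exp_shift_neq_1'[OF b, of n], unfolded this,
        OF exp_shift_neq_1'[OF ab, of "m + n"]]
    show "(half_sgn m + ?f a m) * (half_sgn n + ?f b n) + 1 / 4 =
       (half_sgn (m + n) + ?f (a + b) (m + n)) * ((half_sgn m + ?f a m) + (half_sgn n + ?f b n)) +
       (if m + n = 0 then 0 else 0)"
      unfolding half_sgn_add_half_coth_reg add by simp
  qed (rule half_coth_reg_summable s has_sum_0_simp)+
  thus ?thesis by (simp add: algebra_simps)
qed

text \<open>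
The limiting case \<open>b = - a\<close>. The addition theorem of \<open>half_coth\<close> then fails for \<open>m + n = 0\<close>, where it is
replaced by \<open>half_coth\<^sup>2 = cosech_sq + 1/4\<close>; the sum of these exceptional terms produces \<open>qwp 0\<close>.
\<close>

theorem qzeta_square:
  assumes a: "a \<in> punctured_strip w"
  shows "qzeta a w ^ 2 - qwp 0 a w - 2 * qheat a w = qheat 0 w + 1 / 4"
proof -
  let ?f = "\<lambda>v m. half_coth_reg m (v + of_int m * w)"
  have s: "\<bar>Re a\<bar> < - Re w" "\<bar>Re (- a)\<bar> < - Re w" "\<bar>Re (0::complex)\<bar> < - Re w"
    using assms by (auto simp: punctured_strip_def)
  have "qzeta a w * qzeta (- a) w - qzeta 0 w * (qzeta a w + qzeta (- a) w)
      - (- qheat a w) - (- qheat (- a) w) - (- qheat 0 w) + 1 / 4 = - qwp 0 a w"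
  proof (rule regularised_convolution[of "?f a" "?f (- a)" "?f 0" "\<lambda>m. - cosech_sq (a + of_int m * w)"])
    fix m n
    have a': "- a \<in> punctured_strip w"
      using a by (auto simp: punctured_strip_def exp_minus)
    show "(half_sgn m + ?f a m) * (half_sgn n + ?f (- a) n) + 1 / 4 =
       (half_sgn (m + n) + ?f 0 (m + n)) * ((half_sgn m + ?f a m) + (half_sgn n + ?f (- a) n)) +
       (if m + n = 0 then - cosech_sq (a + of_int m * w) else 0)"
    proof (cases "m + n = 0")
      case True
      hence "n = - m" by simp
      thus ?thesis
        using half_coth_minus[of "a + of_int m * w"]
        by (simp add: half_sgn_add_half_coth_reg half_coth_reg_def half_coth_def[of 0] cosech_sq_def power2_eq_square)
    next
      case False
      have "(a + of_int m * w) + (- a + of_int n * w) = 0 + of_int (m + n) * w"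
        by (simp add: algebra_simps)
      note add = half_coth_add[OF exp_shift_neq_1'[OF a, of m] exp_shift_neq_1'[OF a', of n], unfolded this,
          OF exp_shift_neq_1[OF s(3) False]]
      show ?thesis
        unfolding half_sgn_add_half_coth_reg add using False by simp
    qed
  qed (rule half_coth_reg_summable s has_sum_uminusI[OF cosech_sq_has_sum])+
  thus ?thesis by (simp add: qzeta_minus qheat_minus power2_eq_square algebra_simps)
qed

section \<open>Differential consequences of the addition theorem\<close>

text \<open>
Half of the derivative of \<open>qwp 0\<close>, in the form in which differentiating \<open>qzeta_square\<close> produces it.
Solved for \<open>qwp 1\<close>, the definition is the equation \<open>\<rho>\<^sub>w = - \<rho> \<rho>\<^sub>v + \<rho>\<^sub>v\<^sub>v / 2\<close> for \<open>\<rho> =\<close> \<open>qzeta\<close>, which is the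
heat equation of the theta function after taking a logarithmic derivative.
\<close>

definition qwp_prime :: "complex \<Rightarrow> complex \<Rightarrow> complex" where
  "qwp_prime v w = qwp 1 v w + qzeta v w * qwp 0 v w"

lemma qwp0_deriv_v:
  assumes v: "v \<in> punctured_strip w"
  shows "((\<lambda>v. qwp 0 v w) has_field_derivative 2 * qwp_prime v w) (at v)"
proof -
  have "((\<lambda>v. qzeta v w ^ 2 - 2 * qheat v w - (qheat 0 w + 1 / 4)) has_field_derivative
      2 * qwp_prime v w) (at v)"
    by (auto intro!: derivative_eq_intros qzeta_deriv_v qheat_deriv_v v simp: qwp_prime_def algebra_simps)
  thus ?thesis
    by (rule has_field_derivative_transform_within_open[OF _ open_punctured_strip v])
       (use qzeta_square in \<open>simp add: algebra_simps\<close>)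
qed

lemma qwp_prime_deriv_v:
  assumes v: "v \<in> punctured_strip w"
  shows "((\<lambda>v. qwp_prime v w) has_field_derivative
           qwp_mixed v w + qwp 0 v w ^ 2 + 2 * qzeta v w * qwp_prime v w) (at v)"
  unfolding qwp_prime_def[abs_def]
  by (rule derivative_eq_intros qzeta_deriv_v qwp1_deriv_v qwp0_deriv_v v refl)+
     (simp add: qwp_prime_def power2_eq_square)

lemma eventually_add_in_punctured_strip:
  assumes "a \<in> punctured_strip w" "a + b \<in> punctured_strip w"
  shows "eventually (\<lambda>x. x \<in> punctured_strip w \<and> x + b \<in> punctured_strip w) (nhds a)"
proof -
  have "(\<lambda>x. x + b) -` punctured_strip w = (+) (- b) ` punctured_strip w"
    by (force simp: image_iff)
  hence "open (punctured_strip w \<inter> (\<lambda>x. x + b) -` punctured_strip w)"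
    using open_punctured_strip by (metis open_Int open_translation)
  from eventually_nhds_in_open[OF this, of a] show ?thesis
    using assms by simp
qed

lemma qzeta_shift_deriv:
  assumes "a + b \<in> punctured_strip w"
  shows "((\<lambda>x. qzeta (x + b) w) has_field_derivative qwp 0 (a + b) w) (at a)"
    and "((\<lambda>x. qheat (x + b) w) has_field_derivative - qwp 1 (a + b) w) (at a)"
    and "((\<lambda>x. qwp 0 (x + b) w) has_field_derivative 2 * qwp_prime (a + b) w) (at a)"
    and "((\<lambda>x. qwp_prime (x + b) w) has_field_derivative
           qwp_mixed (a + b) w + qwp 0 (a + b) w ^ 2 + 2 * qzeta (a + b) w * qwp_prime (a + b) w) (at a)"
  by (rule DERIV_shift[THEN iffD1, OF qzeta_deriv_v[OF assms]] DERIV_shift[THEN iffD1, OF qheat_deriv_v[OF assms]]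
      DERIV_shift[THEN iffD1, OF qwp0_deriv_v[OF assms]] DERIV_shift[THEN iffD1, OF qwp_prime_deriv_v[OF assms]])+

lemma has_field_derivative_eventually_const:
  assumes "(f has_field_derivative D) (at a)" "eventually (\<lambda>x. f x = c) (nhds a)"
  shows "D = 0"
proof -
  have "(f has_field_derivative D) (at a) \<longleftrightarrow> ((\<lambda>_. c) has_field_derivative D) (at a)"
    by (rule DERIV_cong_ev) (use assms(2) in auto)
  thus ?thesis using assms(1) DERIV_unique[OF _ DERIV_const] by blast
qed

text \<open>
The \<open>a\<close>-derivative of \<open>qzeta_add\<close>.
\<close>

lemma qwp_prime_add:
  assumes a: "a \<in> punctured_strip w" and b: "b \<in> punctured_strip w" and ab: "a + b \<in> punctured_strip w"
  shows "qwp_prime a w + qwp_prime (a + b) w =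
           (qzeta a w + qzeta b w - qzeta (a + b) w) * (qwp 0 a w - qwp 0 (a + b) w)"
proof -
  have "((\<lambda>x. qzeta x w * qzeta b w - qzeta (x + b) w * (qzeta x w + qzeta b w) +
           qheat x w + qheat b w + qheat (x + b) w) has_field_derivative
         qwp 0 a w * qzeta b w - (qwp 0 (a + b) w * (qzeta a w + qzeta b w) + qwp 0 a w * qzeta (a + b) w)
          - qwp 1 a w - qwp 1 (a + b) w) (at a)"
    by (rule derivative_eq_intros qzeta_deriv_v qheat_deriv_v qzeta_shift_deriv a ab refl)+ simp
  moreover have "eventually (\<lambda>x. qzeta x w * qzeta b w - qzeta (x + b) w * (qzeta x w + qzeta b w) +
           qheat x w + qheat b w + qheat (x + b) w = - 1 / 4) (nhds a)"
    using eventually_add_in_punctured_strip[OF a ab]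
    by eventually_elim (use qzeta_add[OF _ b] in blast)
  ultimately have "qwp 0 a w * qzeta b w - (qwp 0 (a + b) w * (qzeta a w + qzeta b w) + qwp 0 a w * qzeta (a + b) w)
          - qwp 1 a w - qwp 1 (a + b) w = 0"
    by (rule has_field_derivative_eventually_const)
  thus ?thesis
    unfolding qwp_prime_def by algebra
qed

text \<open>
The \<open>b\<close>-derivative of \<open>qwp_prime_add\<close>. The left-hand side is the \<open>v\<close>-derivative of \<open>qwp_prime\<close>.
\<close>

lemma qwp_mixed_add:
  assumes a: "a \<in> punctured_strip w" and b: "b \<in> punctured_strip w" and ab: "a + b \<in> punctured_strip w"
  defines "c \<equiv> qzeta a w + qzeta b w - qzeta (a + b) w"
  shows "qwp_mixed (a + b) w + qwp 0 (a + b) w ^ 2 + 2 * qzeta (a + b) w * qwp_prime (a + b) w =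
           (qwp 0 b w - qwp 0 (a + b) w) * (qwp 0 a w - qwp 0 (a + b) w) - 2 * c * qwp_prime (a + b) w"
proof -
  have ba: "b + a \<in> punctured_strip w" using ab by (simp add: add.commute)
  have "((\<lambda>x. qwp_prime a w + qwp_prime (x + a) w -
           (qzeta a w + qzeta x w - qzeta (x + a) w) * (qwp 0 a w - qwp 0 (x + a) w)) has_field_derivative
         (qwp_mixed (b + a) w + qwp 0 (b + a) w ^ 2 + 2 * qzeta (b + a) w * qwp_prime (b + a) w) -
         ((qwp 0 b w - qwp 0 (b + a) w) * (qwp 0 a w - qwp 0 (b + a) w) +
          - (2 * qwp_prime (b + a) w) * (qzeta a w + qzeta b w - qzeta (b + a) w))) (at b)"
    by (rule derivative_eq_intros qzeta_deriv_v qzeta_shift_deriv b ba refl)+ simp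
  moreover have "eventually (\<lambda>x. qwp_prime a w + qwp_prime (x + a) w -
           (qzeta a w + qzeta x w - qzeta (x + a) w) * (qwp 0 a w - qwp 0 (x + a) w) = 0) (nhds b)"
    using eventually_add_in_punctured_strip[OF b ba]
    by eventually_elim (use qwp_prime_add[OF a] in \<open>simp add: add.commute\<close>)
  ultimately have "(qwp_mixed (b + a) w + qwp 0 (b + a) w ^ 2 + 2 * qzeta (b + a) w * qwp_prime (b + a) w) -
         ((qwp 0 b w - qwp 0 (b + a) w) * (qwp 0 a w - qwp 0 (b + a) w) +
          - (2 * qwp_prime (b + a) w) * (qzeta a w + qzeta b w - qzeta (b + a) w)) = 0"
    by (rule has_field_derivative_eventually_const)
  thus ?thesis
    unfolding c_def add.commute[of b a] by algebra
qed

section \<open>The differential system at the points of order six\<close>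

definition torsion :: "nat \<Rightarrow> complex" where
  "torsion k = of_nat k * (of_real pi * \<i> / 3)"

lemma torsion_add:
  "torsion 1 + torsion 1 = torsion 2" "torsion 1 + torsion 2 = torsion 3"
  "torsion 2 + torsion 1 = torsion 3" "torsion 2 + torsion 2 = torsion 4"
  by (simp_all add: torsion_def)

lemma Re_torsion [simp]: "Re (torsion k) = 0"
  by (simp add: torsion_def)

lemma exp_torsion: "exp (torsion k) = cis (real k * pi / 3)"
  by (simp add: torsion_def cis_conv_exp mult_ac)

lemma exp_torsion_1: "exp (torsion 1) = Complex (1 / 2) (sqrt 3 / 2)"
  by (simp add: exp_torsion complex_eq_iff cos_60 sin_60)

lemma exp_torsion_2: "exp (torsion 2) = Complex (- 1 / 2) (sqrt 3 / 2)"
  by (rule complex_eqI) (use cos_120 sin_120 in \<open>simp_all add: exp_torsion mult.commute\<close>)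

lemma exp_torsion_3: "exp (torsion 3) = - 1"
  by (simp add: exp_torsion)

lemma exp_torsion_4: "exp (torsion 4) = Complex (- 1 / 2) (- sqrt 3 / 2)"
proof -
  have "exp (torsion 4) = exp (torsion 2) * exp (torsion 2)"
    by (simp add: exp_add[symmetric] torsion_add)
  thus ?thesis by (simp add: exp_torsion_2 complex_eq_iff field_simps)
qed

lemma torsion_in_punctured_strip:
  assumes "Re w < 0"
  shows "torsion 1 \<in> punctured_strip w" "torsion 2 \<in> punctured_strip w"
    "torsion 3 \<in> punctured_strip w" "torsion 4 \<in> punctured_strip w"
  using assms
  by (auto simp: punctured_strip_def exp_torsion_2 exp_torsion_3 exp_torsion_4 complex_eq_iff
      exp_torsion_1[unfolded One_nat_def])

text \<open>
Modular forms of weight 1 for \<open>\<Gamma>\<^sub>1(6)\<close>: the zeta values at a point of order 6 and at its double. The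
value at the point of order 2 vanishes because \<open>qzeta\<close> is odd
and has period \<open>2 \<pi> \<i>\<close>.
\<close>

definition alpha :: "complex \<Rightarrow> complex" where "alpha w = qzeta (torsion 1) w"
definition beta :: "complex \<Rightarrow> complex" where "beta w = qzeta (torsion 2) w"

text \<open>
This is \<open>E\<^sub>2(q) / 12\<close>, the quasi-modular part of the system.
\<close>

definition kappa :: "complex \<Rightarrow> complex" where "kappa w = 1 / 12 + qheat 0 w"

lemma qzeta_torsion_3: "qzeta (torsion 3) w = 0"
proof -
  have "- torsion 3 + 2 * of_real pi * \<i> = torsion 3"
    by (simp add: torsion_def)
  from qzeta_add_two_pi_i[of "- torsion 3" w, unfolded this qzeta_minus]
  have "qzeta (torsion 3) w = - qzeta (torsion 3) w" .
  thus ?thesis by simp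
qed

lemma torsion_4: "torsion 4 = - torsion 2 + 2 * of_real pi * \<i>"
  by (simp add: torsion_def field_simps)

text \<open>
The addition theorem at the pairs \<open>(1, 1)\<close>, \<open>(1, 2)\<close>, \<open>(2, 2)\<close> of multiples of the point of order 6 is a
triangular linear system for the three values.
\<close>

lemma qheat_torsion:
  assumes w: "Re w < 0"
  defines "a \<equiv> alpha w" and "b \<equiv> beta w"
  shows "qheat (torsion 1) w = - 1 / 12 - a\<^sup>2 / 2 + a * b + b\<^sup>2 / 2"
    and "qheat (torsion 2) w = - 1 / 12 - b\<^sup>2"
    and "qheat (torsion 3) w = - 1 / 12 + a\<^sup>2 / 2 - 2 * a * b + b\<^sup>2 / 2"
proof -
  note str = torsion_in_punctured_strip[OF w]
  have 1: "a * a - b * (a + a) + 2 * qheat (torsion 1) w + qheat (torsion 2) w = - 1 / 4"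
    using qzeta_add[of "torsion 1" w "torsion 1", unfolded torsion_add, OF str(1) str(1) str(2)]
    unfolding a_def b_def alpha_def beta_def by algebra
  have 2: "a * b + qheat (torsion 1) w + qheat (torsion 2) w + qheat (torsion 3) w = - 1 / 4"
    using qzeta_add[of "torsion 1" w "torsion 2", unfolded torsion_add] str qzeta_torsion_3[of w]
    by (simp add: a_def b_def alpha_def beta_def)
  have "qzeta (torsion 4) w = - b" "qheat (torsion 4) w = qheat (torsion 2) w"
    unfolding torsion_4 qzeta_add_two_pi_i qheat_add_two_pi_i qzeta_minus qheat_minus b_def beta_def by simp_all
  hence 3: "b * b + b * (b + b) + 3 * qheat (torsion 2) w = - 1 / 4"
    using qzeta_add[of "torsion 2" w "torsion 2", unfolded torsion_add] str
    by (simp add: b_def beta_def add_ac)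
  from 3 show s2: "qheat (torsion 2) w = - 1 / 12 - b\<^sup>2"
    by (simp add: power2_eq_square field_simps)
  with 1 have "2 * qheat (torsion 1) w = 2 * (- 1 / 12 - a\<^sup>2 / 2 + a * b + b\<^sup>2 / 2)"
    by (simp add: power2_eq_square algebra_simps)
  thus s1: "qheat (torsion 1) w = - 1 / 12 - a\<^sup>2 / 2 + a * b + b\<^sup>2 / 2"
    unfolding mult_cancel_left by simp
  have "qheat (torsion 3) w = - 1 / 4 - a * b - qheat (torsion 1) w - qheat (torsion 2) w"
    using 2 by (simp add: algebra_simps)
  also have "\<dots> = - 1 / 12 + a\<^sup>2 / 2 - 2 * a * b + b\<^sup>2 / 2"
    unfolding s1 s2 by (simp add: field_simps)
  finally show "qheat (torsion 3) w = - 1 / 12 + a\<^sup>2 / 2 - 2 * a * b + b\<^sup>2 / 2" .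
qed

lemma qwp_torsion:
  assumes w: "Re w < 0"
  defines "a \<equiv> alpha w" and "b \<equiv> beta w" and "k \<equiv> kappa w"
  shows "qwp 0 (torsion 1) w = 2 * a\<^sup>2 - 2 * a * b - b\<^sup>2 - k"
    and "qwp 0 (torsion 2) w = 3 * b\<^sup>2 - k"
    and "qwp 0 (torsion 3) w = - a\<^sup>2 + 4 * a * b - b\<^sup>2 - k"
proof -
  note str = torsion_in_punctured_strip[OF w]
  note S = qheat_torsion[OF w, folded a_def b_def]
  have q: "qwp 0 (torsion j) w = qzeta (torsion j) w ^ 2 - 2 * qheat (torsion j) w - k - 1 / 6"
    if "torsion j \<in> punctured_strip w" for j
    using qzeta_square[OF that] unfolding k_def kappa_def by algebra
  show "qwp 0 (torsion 1) w = 2 * a\<^sup>2 - 2 * a * b - b\<^sup>2 - k"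
    unfolding q[OF str(1)] S alpha_def[symmetric] a_def[symmetric] by (simp add: field_simps)
  show "qwp 0 (torsion 2) w = 3 * b\<^sup>2 - k"
    unfolding q[OF str(2)] S beta_def[symmetric] b_def[symmetric] by (simp add: field_simps)
  show "qwp 0 (torsion 3) w = - a\<^sup>2 + 4 * a * b - b\<^sup>2 - k"
    unfolding q[OF str(3)] S qzeta_torsion_3 by (simp add: field_simps)
qed

text \<open>
Here \<open>qwp_prime_add\<close> at the pairs \<open>(1, 1)\<close>, \<open>(1, 2)\<close>, \<open>(2, 1)\<close> gives three linear equations for the values
at the points 1, 2, 3.
\<close>

lemma qwp_prime_torsion:
  assumes w: "Re w < 0"
  defines "a \<equiv> alpha w" and "b \<equiv> beta w"
  shows "qwp_prime (torsion 1) w = 3 * a * (a + b) * (a - 2 * b)"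
    and "qwp_prime (torsion 2) w = (a + b) * (a - 2 * b)\<^sup>2"
proof -
  note str = torsion_in_punctured_strip[OF w]
  define k where "k = kappa w"
  note Q = qwp_torsion[OF w, folded a_def b_def k_def]
  have 1: "qwp_prime (torsion 1) w + qwp_prime (torsion 2) w =
        (2 * a - b) * (qwp 0 (torsion 1) w - qwp 0 (torsion 2) w)"
    using qwp_prime_add[of "torsion 1" w "torsion 1", unfolded torsion_add] str
    by (simp add: a_def b_def alpha_def beta_def)
  have 2: "qwp_prime (torsion 1) w + qwp_prime (torsion 3) w =
        (a + b) * (qwp 0 (torsion 1) w - qwp 0 (torsion 3) w)"
    using qwp_prime_add[of "torsion 1" w "torsion 2", unfolded torsion_add] str qzeta_torsion_3[of w]
    by (simp add: a_def b_def alpha_def beta_def)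
  have 3: "qwp_prime (torsion 2) w + qwp_prime (torsion 3) w =
        (a + b) * (qwp 0 (torsion 2) w - qwp 0 (torsion 3) w)"
    using qwp_prime_add[of "torsion 2" w "torsion 1", unfolded torsion_add] str qzeta_torsion_3[of w]
    by (simp add: a_def b_def alpha_def beta_def add_ac)
  have "2 * qwp_prime (torsion 1) w = 2 * (3 * a * (a + b) * (a - 2 * b))"
    using 1 2 3 unfolding Q by algebra
  thus "qwp_prime (torsion 1) w = 3 * a * (a + b) * (a - 2 * b)" by simp
  with 1 show "qwp_prime (torsion 2) w = (a + b) * (a - 2 * b)\<^sup>2"
    unfolding Q by algebra
qed

text \<open>
This derivative and the next follow from the equation \<open>\<rho>\<^sub>w = - \<rho> \<rho>\<^sub>v + \<rho>\<^sub>v\<^sub>v / 2\<close> contained in \<open>qwp_prime\<close>: the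
\<open>v\<close>-derivatives on its right-hand side are known at the points of order 6.
\<close>

lemma alpha_deriv:
  assumes w: "Re w < 0"
  shows "(alpha has_field_derivative
           alpha w * (alpha w ^ 2 - alpha w * beta w - 5 * beta w ^ 2 + kappa w)) (at w)"
proof -
  note str = torsion_in_punctured_strip[OF w]
  have "qwp 1 (torsion 1) w = qwp_prime (torsion 1) w - alpha w * qwp 0 (torsion 1) w"
    by (simp add: qwp_prime_def alpha_def)
  also have "\<dots> = alpha w * (alpha w ^ 2 - alpha w * beta w - 5 * beta w ^ 2 + kappa w)"
    unfolding qwp_prime_torsion[OF w] qwp_torsion[OF w] by algebra
  finally show ?thesis
    using qzeta_deriv_w[OF str(1)] by (simp add: alpha_def[abs_def])
qed

lemma beta_deriv:
  assumes w: "Re w < 0"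
  shows "(beta has_field_derivative
           alpha w ^ 3 - 3 * alpha w ^ 2 * beta w + beta w ^ 3 + kappa w * beta w) (at w)"
proof -
  note str = torsion_in_punctured_strip[OF w]
  have "qwp 1 (torsion 2) w = qwp_prime (torsion 2) w - beta w * qwp 0 (torsion 2) w"
    by (simp add: qwp_prime_def beta_def)
  also have "\<dots> = alpha w ^ 3 - 3 * alpha w ^ 2 * beta w + beta w ^ 3 + kappa w * beta w"
    unfolding qwp_prime_torsion[OF w] qwp_torsion[OF w] by algebra
  finally show ?thesis
    using qzeta_deriv_w[OF str(2)] by (simp add: beta_def[abs_def])
qed

lemma open_left_half_plane: "open {w. Re w < 0}"
  by (intro open_Collect_less continuous_intros)

text \<open>
By \<open>qwp_torsion\<close>, \<open>\<kappa> = 3 \<beta>\<^sup>2 - \<wp>\<close> with \<open>\<wp>\<close> the value of \<open>qwp 0\<close> at the point of order 3. Its \<open>w\<close>-derivative is a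
\<open>qwp_mixed\<close>, which \<open>qwp_mixed_add\<close> evaluates at the doubled point of order 6.
\<close>

lemma kappa_deriv:
  assumes w: "Re w < 0"
  shows "(kappa has_field_derivative
     kappa w ^ 2 - 9 * beta w ^ 4 + 2 * beta w * (alpha w + beta w) * (alpha w - 2 * beta w)\<^sup>2) (at w)"
proof -
  note str = torsion_in_punctured_strip[OF w]
  define a b k where "a = alpha w" and "b = beta w" and "k = kappa w"
  note Q = qwp_torsion[OF w, folded a_def b_def k_def]
  note P = qwp_prime_torsion[OF w, folded a_def b_def]
  have "qwp_mixed (torsion 2) w + qwp 0 (torsion 2) w ^ 2 + 2 * b * qwp_prime (torsion 2) w =
      (qwp 0 (torsion 1) w - qwp 0 (torsion 2) w)\<^sup>2 - 2 * (2 * a - b) * qwp_prime (torsion 2) w"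
    using qwp_mixed_add[of "torsion 1" w "torsion 1", unfolded torsion_add] str
    by (simp add: a_def b_def alpha_def beta_def power2_eq_square)
  hence mixed: "qwp_mixed (torsion 2) w = 4 * b * ((a + b) * (a - 2 * b)\<^sup>2) - (3 * b\<^sup>2 - k)\<^sup>2"
    unfolding P Q by algebra
  have "((\<lambda>w. 3 * beta w ^ 2 - qwp 0 (torsion 2) w) has_field_derivative
      6 * beta w * (a ^ 3 - 3 * a ^ 2 * b + b ^ 3 + k * b) - qwp_mixed (torsion 2) w) (at w)"
    unfolding a_def b_def k_def
    by (rule derivative_eq_intros beta_deriv qwp0_deriv_w str w refl)+ simp
  also have "6 * beta w * (a ^ 3 - 3 * a ^ 2 * b + b ^ 3 + k * b) - qwp_mixed (torsion 2) w =
      k ^ 2 - 9 * b ^ 4 + 2 * b * (a + b) * (a - 2 * b)\<^sup>2"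
    unfolding mixed b_def[symmetric] by algebra
  finally have "((\<lambda>w. 3 * beta w ^ 2 - qwp 0 (torsion 2) w) has_field_derivative
      k ^ 2 - 9 * b ^ 4 + 2 * b * (a + b) * (a - 2 * b)\<^sup>2) (at w)" .
  thus ?thesis
    unfolding a_def b_def k_def
    by (rule has_field_derivative_transform_within_open[OF _ open_left_half_plane])
       (use w qwp_torsion(2) in auto)
qed

section \<open>The eta function and Lambert series\<close>

definition euler_prod :: "complex \<Rightarrow> complex" where
  "euler_prod q = (\<Prod>n. 1 - q ^ Suc n)"

lemma power_Suc_neq_1: "norm q < 1 \<Longrightarrow> q ^ Suc n \<noteq> (1 :: complex)"
  using power_eq_1_iff[of q "Suc n"] by auto

lemma euler_prod_convergent:
  assumes "norm q < 1"
  shows "convergent_prod (\<lambda>n. 1 - q ^ Suc n :: complex)"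
proof -
  have "summable (\<lambda>n. norm q ^ Suc n)"
    using assms by (subst summable_Suc_iff) (intro summable_geometric, simp)
  hence "convergent_prod (\<lambda>n. 1 + - (q ^ Suc n))"
    using power_Suc_neq_1[OF assms]
    by (intro summable_imp_convergent_prod_complex) (auto simp: norm_power norm_mult simp del: power_Suc)
  thus ?thesis by simp
qed

lemma euler_prod_nonzero:
  assumes "norm q < 1"
  shows "euler_prod q \<noteq> 0"
  unfolding euler_prod_def
  using euler_prod_convergent[OF assms] power_Suc_neq_1[OF assms]
  by (intro prodinf_nonzero) auto

lemma euler_prod_0 [simp]: "euler_prod 0 = 1"
  by (simp add: euler_prod_def)

lemma uniform_limit_euler_prod:
  assumes "r < 1"
  shows "uniform_limit (ball 0 r) (\<lambda>n q. \<Prod>k<n. 1 - q ^ Suc k) euler_prod sequentially"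
proof (cases "r > 0")
  case False
  hence empty: "ball (0::complex) r = {}" by simp
  show ?thesis unfolding empty by (simp add: uniform_limit_iff)
next
  case True
  have "uniformly_convergent_on (cball 0 r) (\<lambda>N q. \<Prod>n<N. 1 - q ^ Suc n :: complex)"
  proof (rule uniformly_convergent_on_prod')
    have "uniformly_convergent_on (cball 0 r) (\<lambda>N q. \<Sum>n<N. norm (q :: complex) ^ Suc n)"
    proof (rule Weierstrass_m_test')
      show "summable (\<lambda>n. r ^ Suc n)"
        using assms True by (subst summable_Suc_iff) (intro summable_geometric, simp)
    qed (use True in \<open>auto intro!: power_mono mult_mono simp: norm_power norm_mult\<close>)
    thus "uniformly_convergent_on (cball 0 r) (\<lambda>N q. \<Sum>n<N. norm (1 - q ^ Suc n - 1 :: complex))"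
      by (simp add: norm_power norm_mult)
  qed (auto intro!: continuous_intros)
  hence "uniformly_convergent_on (ball 0 r) (\<lambda>N q. \<Prod>n<N. 1 - q ^ Suc n :: complex)"
    by (rule uniformly_convergent_on_subset) auto
  hence *: "uniform_limit (ball 0 r) (\<lambda>n q. \<Prod>k<n. 1 - q ^ Suc k)
      (\<lambda>q. lim (\<lambda>n. \<Prod>k<n. 1 - q ^ Suc k :: complex)) sequentially"
    by (simp add: uniformly_convergent_uniform_limit_iff)
  have "lim (\<lambda>n. \<Prod>k<n. 1 - q ^ Suc k :: complex) = euler_prod q" if "q \<in> ball 0 r" for q
  proof (rule limI)
    have "norm q < 1" using that assms by simp
    from convergent_prod_LIMSEQ[OF euler_prod_convergent[OF this]]
    have "(\<lambda>n. \<Prod>k<Suc n. 1 - q ^ Suc k) \<longlonglongrightarrow> euler_prod q"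
      by (simp add: euler_prod_def lessThan_Suc_atMost)
    thus "(\<lambda>n. \<Prod>k<n. 1 - q ^ Suc k) \<longlonglongrightarrow> euler_prod q"
      by (rule LIMSEQ_imp_Suc)
  qed
  thus ?thesis
    using * by (subst (asm) uniform_limit_cong') auto
qed

definition lambert :: "complex \<Rightarrow> complex" where
  "lambert q = (\<Sum>n. of_nat (Suc n) * (q ^ Suc n / (1 - q ^ Suc n)))"

lemma euler_prod_logderiv:
  assumes q: "norm q < 1"
  shows "(euler_prod has_field_derivative deriv euler_prod q) (at q)"
    and "(\<lambda>n. of_nat (Suc n) * (q ^ Suc n / (1 - q ^ Suc n))) sums lambert q"
    and "q * deriv euler_prod q = - lambert q * euler_prod q"
proof -
  define r where "r = (1 + norm q) / 2"
  have r: "r < 1" "q \<in> ball 0 r" using q by (auto simp: r_def)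
  note ul = uniform_limit_euler_prod[OF r(1)]
  have "euler_prod holomorphic_on ball 0 r"
  proof (rule holomorphic_uniform_sequence[OF open_ball])
    show "(\<lambda>q. \<Prod>k<n. 1 - q ^ Suc k) holomorphic_on ball 0 r" for n
      by (intro holomorphic_intros)
    fix x assume "x \<in> ball (0 :: complex) r"
    then obtain d where d: "d > 0" "cball x d \<subseteq> ball 0 r"
      using open_contains_cball[of "ball 0 r"] open_ball by blast
    thus "\<exists>d>0. cball x d \<subseteq> ball 0 r \<and>
        uniform_limit (cball x d) (\<lambda>n q. \<Prod>k<n. 1 - q ^ Suc k) euler_prod sequentially"
      using uniform_limit_on_subset[OF ul] by blast
  qed
  thus "(euler_prod has_field_derivative deriv euler_prod q) (at q)"
    using r(2) by (rule holomorphic_derivI[OF _ open_ball])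
  have "(\<lambda>k. deriv (\<lambda>q. 1 - q ^ Suc k) q / (1 - q ^ Suc k)) sums (deriv euler_prod q / euler_prod q)"
    by (rule logderiv_prodinf_complex_uniform_limit[OF ul])
       (use q r in \<open>auto intro!: holomorphic_intros euler_prod_nonzero\<close>)
  moreover have "deriv (\<lambda>q. 1 - q ^ Suc k) q = - of_nat (Suc k) * q ^ k" for k
    by (rule DERIV_imp_deriv) (auto intro!: derivative_eq_intros simp del: power_Suc simp: algebra_simps)
  ultimately have "(\<lambda>k. - of_nat (Suc k) * q ^ k / (1 - q ^ Suc k)) sums (deriv euler_prod q / euler_prod q)"
    by simp
  from sums_mult[OF this, of "- q"]
  have *: "(\<lambda>n. of_nat (Suc n) * (q ^ Suc n / (1 - q ^ Suc n))) sums (- q * (deriv euler_prod q / euler_prod q))"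
    by (simp add: mult_ac del: of_nat_Suc)
  from sums_unique[OF this] have eq: "lambert q = - q * (deriv euler_prod q / euler_prod q)"
    by (simp add: lambert_def)
  show "(\<lambda>n. of_nat (Suc n) * (q ^ Suc n / (1 - q ^ Suc n))) sums lambert q"
    using * eq by simp
  show "q * deriv euler_prod q = - lambert q * euler_prod q"
    unfolding eq using euler_prod_nonzero[OF q] by simp
qed

definition eta_exp :: "complex \<Rightarrow> complex" where
  "eta_exp x = exp (x / 24) * euler_prod (exp x)"

definition eta_logderiv :: "complex \<Rightarrow> complex" where
  "eta_logderiv x = 1 / 24 - lambert (exp x)"

text \<open>
The argument \<open>x = 2 \<pi> \<i> \<tau>\<close> turns the arguments \<open>\<tau> / 2\<close>, \<open>\<tau>\<close>, \<open>3 \<tau> / 2\<close>, \<open>3 \<tau>\<close> of the eta functions into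
\<open>w\<close>, \<open>2 w\<close>, \<open>3 w\<close>, \<open>6 w\<close>.
\<close>

lemma dedekind_eta_conv_eta_exp: "dedekind_eta \<tau> = eta_exp (2 * of_real pi * \<i> * \<tau>)"
  by (simp add: dedekind_eta_def eta_exp_def euler_prod_def exp_of_nat_mult[symmetric] algebra_simps exp_add)

lemma eta_exp_nonzero: "Re x < 0 \<Longrightarrow> eta_exp x \<noteq> 0"
  by (simp add: eta_exp_def euler_prod_nonzero)

lemma eta_exp_deriv:
  assumes "Re x < 0"
  shows "(eta_exp has_field_derivative eta_exp x * eta_logderiv x) (at x)"
proof -
  have q: "norm (exp x) < 1" using assms by simp
  have "((\<lambda>x. exp (x / 24)) has_field_derivative exp (x / 24) * (1 / 24)) (at x)"
    by (auto intro!: derivative_eq_intros)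
  from DERIV_mult'[OF this DERIV_chain2[where f = euler_prod and g = exp, OF euler_prod_logderiv(1)[OF q] DERIV_exp]]
  have "((\<lambda>x. exp (x / 24) * euler_prod (exp x)) has_field_derivative
      exp (x / 24) * (deriv euler_prod (exp x) * exp x) + exp (x / 24) * (1 / 24) * euler_prod (exp x)) (at x)" .
  also have "exp (x / 24) * (deriv euler_prod (exp x) * exp x) + exp (x / 24) * (1 / 24) * euler_prod (exp x) =
      eta_exp x * eta_logderiv x"
    using euler_prod_logderiv(3)[OF q] unfolding eta_exp_def eta_logderiv_def
    by (simp add: algebra_simps)
  finally show ?thesis by (simp add: eta_exp_def[abs_def])
qed

lemma has_sum_int_sums:
  fixes f :: "int \<Rightarrow> complex"
  assumes "(f has_sum S) UNIV"
  shows "(\<lambda>n. f (int (Suc n)) + f (- int (Suc n))) sums (S - f 0)"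
proof -
  have half: "((\<lambda>n. f (g n)) has_sum infsum f (range g)) UNIV" if "inj g" for g :: "nat \<Rightarrow> int"
  proof -
    have "f summable_on range g"
      using assms summable_on_subset_banach has_sum_imp_summable by blast
    hence "(f has_sum infsum f (range g)) (range g)" by simp
    thus ?thesis using that by (simp add: has_sum_reindex o_def)
  qed
  define g1 g2 where "g1 = (\<lambda>n. int (Suc n))" and "g2 = (\<lambda>n. - int (Suc n))"
  have inj: "inj g1" "inj g2" by (auto simp: inj_on_def g1_def g2_def)
  have sub: "(f has_sum infsum f A) A" for A
    using assms summable_on_subset_banach has_sum_imp_summable by (metis has_sum_infsum subset_UNIV)
  have "(f has_sum f 0) {0}"
    by (rule has_sum_finiteI) auto
  hence "(f has_sum (f 0 + (infsum f (range g1) + infsum f (range g2)))) ({0} \<union> (range g1 \<union> range g2))"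
    by (intro has_sum_Un_disjoint sub) (auto simp: g1_def g2_def)
  also have "{0} \<union> (range g1 \<union> range g2) = UNIV"
  proof -
    have "n \<in> {0} \<union> (range g1 \<union> range g2)" for n
    proof (cases n rule: int_cases3)
      case (pos k)
      hence "n = g1 (k - 1)" by (simp add: g1_def)
      thus ?thesis by blast
    next
      case (neg k)
      hence "n = g2 (k - 1)" by (simp add: g2_def)
      thus ?thesis by blast
    qed simp
    thus ?thesis by blast
  qed
  finally have "S = f 0 + (infsum f (range g1) + infsum f (range g2))"
    using assms has_sum_unique by blast
  moreover have "(\<lambda>n. f (g1 n) + f (g2 n)) sums (infsum f (range g1) + infsum f (range g2))"
    by (intro sums_add has_sum_imp_sums half inj)
  ultimately show ?thesis by (simp add: g1_def g2_def)
qed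

lemma half_coth_reg_pair:
  assumes "\<bar>Re v\<bar> < - Re w"
  defines "x \<equiv> \<lambda>n. exp w ^ Suc n"
  shows "half_coth_reg (int (Suc n)) (v + of_int (int (Suc n)) * w) = exp v * x n / (1 - exp v * x n)"
    and "half_coth_reg (- int (Suc n)) (v + of_int (- int (Suc n)) * w) = - (x n / exp v / (1 - x n / exp v))"
proof -
  have e: "exp (v + of_int (int (Suc n)) * w) = exp v * x n" for v
    by (simp only: x_def exp_add of_int_of_nat_eq exp_of_nat_mult)
  have pos: "half_coth_reg (int (Suc n)) (v + of_int (int (Suc n)) * w) = exp v * x n / (1 - exp v * x n)"
    if "\<bar>Re v\<bar> < - Re w" for v
  proof -
    have "exp (v + of_int (int (Suc n)) * w) \<noteq> 1"
      by (rule exp_shift_neq_1[OF that]) simp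
    from half_coth_reg_pos[OF _ this, of "int (Suc n)"] show ?thesis
      unfolding e by simp
  qed
  show "half_coth_reg (int (Suc n)) (v + of_int (int (Suc n)) * w) = exp v * x n / (1 - exp v * x n)"
    by (rule pos) fact
  have "half_coth_reg (- int (Suc n)) (v + of_int (- int (Suc n)) * w) =
      - half_coth_reg (int (Suc n)) (- v + of_int (int (Suc n)) * w)"
    by (rule half_coth_reg_reflect)
  also have "half_coth_reg (int (Suc n)) (- v + of_int (int (Suc n)) * w) = exp (- v) * x n / (1 - exp (- v) * x n)"
    by (rule pos) (use assms in simp)
  finally show "half_coth_reg (- int (Suc n)) (v + of_int (- int (Suc n)) * w) = - (x n / exp v / (1 - x n / exp v))"
    by (simp add: exp_minus field_simps)
qed

lemma qheat_sums:
  assumes "\<bar>Re v\<bar> < - Re w"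
  shows "(\<lambda>n. of_nat (Suc n) * (exp v * exp w ^ Suc n / (1 - exp v * exp w ^ Suc n) +
            exp w ^ Suc n / exp v / (1 - exp w ^ Suc n / exp v))) sums (- qheat v w)"
proof -
  have eq: "of_int (int (Suc n)) * x + of_int (- int (Suc n)) * - y = of_nat (Suc n) * (x + y :: complex)" for n x y
    by (simp only: of_int_minus of_int_of_nat_eq minus_mult_minus distrib_left)
  show ?thesis
    using has_sum_int_sums[OF half_coth_reg_summable(4)[OF assms]]
    unfolding half_coth_reg_pair[OF assms] eq by simp
qed

lemma qzeta_sums:
  assumes "\<bar>Re v\<bar> < - Re w"
  shows "(\<lambda>n. exp v * exp w ^ Suc n / (1 - exp v * exp w ^ Suc n) -
            exp w ^ Suc n / exp v / (1 - exp w ^ Suc n / exp v)) sums (qzeta v w - half_coth v)"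
  using has_sum_int_sums[OF half_coth_reg_summable(3)[OF assms]]
  unfolding half_coth_reg_pair[OF assms] by (simp add: half_coth_reg_def[of 0] del: power_Suc)

section \<open>Lambert series at sixth roots of unity\<close>

lemma cyclotomic_nonzero:
  fixes x :: complex
  assumes "norm x < 1"
  shows "1 - x \<noteq> 0" "1 + x \<noteq> 0" "1 + x + x\<^sup>2 \<noteq> 0" "1 - x + x\<^sup>2 \<noteq> 0"
proof -
  have n: "norm (- x) < 1" using assms by simp
  show "1 - x \<noteq> 0" "1 + x \<noteq> 0"
    using power_Suc_neq_1[OF assms, of 0] power_Suc_neq_1[OF n, of 0]
    by (auto simp: add_eq_0_iff minus_equation_iff)
  have *: "1 + y + y\<^sup>2 \<noteq> 0" if "norm y < 1" for y :: complex
  proof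
    assume "1 + y + y\<^sup>2 = 0"
    hence "y ^ 3 = 1" by algebra
    thus False using power_Suc_neq_1[OF that, of 2] by simp
  qed
  show "1 + x + x\<^sup>2 \<noteq> 0" "1 - x + x\<^sup>2 \<noteq> 0"
    using *[OF assms] *[OF n] by simp_all
qed

text \<open>
The terms of \<open>qheat\<close> and \<open>qzeta\<close> depend on \<open>z = exp v\<close> only through \<open>z + 1 / z\<close> and \<open>z - 1 / z\<close>, which are
simple numbers at the points of order 6.
\<close>

lemma geometric_pair_sum:
  fixes z x :: complex
  assumes "norm z = 1" "norm x < 1"
  shows "z * x / (1 - z * x) + x / z / (1 - x / z) = ((z + 1 / z) * x - 2 * x\<^sup>2) / (1 - (z + 1 / z) * x + x\<^sup>2)"
    and "z * x / (1 - z * x) - x / z / (1 - x / z) = (z - 1 / z) * x / (1 - (z + 1 / z) * x + x\<^sup>2)"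
proof -
  have z: "z \<noteq> 0" using assms by auto
  have "norm (z * x) < 1" "norm (x / z) < 1" using assms by (simp_all add: norm_mult norm_divide)
  hence nz: "1 - z * x \<noteq> 0" "1 - x / z \<noteq> 0" using cyclotomic_nonzero(1) by blast+
  have den: "1 - (z + 1 / z) * x + x\<^sup>2 = (1 - z * x) * (1 - x / z)"
    using z by (simp add: field_simps power2_eq_square)
  have "z * x / (1 - z * x) + x / z / (1 - x / z) =
      (z * x * (1 - x / z) + x / z * (1 - z * x)) / ((1 - z * x) * (1 - x / z))"
    by (rule add_frac_eq[OF nz])
  also have "z * x * (1 - x / z) + x / z * (1 - z * x) = (z + 1 / z) * x - 2 * x\<^sup>2"
    using z by (simp add: field_simps power2_eq_square)
  finally show "z * x / (1 - z * x) + x / z / (1 - x / z) = ((z + 1 / z) * x - 2 * x\<^sup>2) / (1 - (z + 1 / z) * x + x\<^sup>2)"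
    unfolding den .
  have "z * x / (1 - z * x) - x / z / (1 - x / z) =
      (z * x * (1 - x / z) - x / z * (1 - z * x)) / ((1 - z * x) * (1 - x / z))"
    by (rule diff_frac_eq[OF nz])
  also have "z * x * (1 - x / z) - x / z * (1 - z * x) = (z - 1 / z) * x"
    using z by (simp add: field_simps power2_eq_square)
  finally show "z * x / (1 - z * x) - x / z / (1 - x / z) = (z - 1 / z) * x / (1 - (z + 1 / z) * x + x\<^sup>2)"
    unfolding den .
qed

lemma torsion_trace:
  shows "exp (torsion 1) + 1 / exp (torsion 1) = 1" "exp (torsion 1) - 1 / exp (torsion 1) = \<i> * sqrt 3"
    "exp (torsion 2) + 1 / exp (torsion 2) = - 1" "exp (torsion 2) - 1 / exp (torsion 2) = \<i> * sqrt 3"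
    "exp (torsion 3) + 1 / exp (torsion 3) = - 2"
proof -
  have "1 / exp (torsion 1) = cnj (exp (torsion 1))" "1 / exp (torsion 2) = cnj (exp (torsion 2))"
    by (simp_all add: exp_torsion cis_cnj cis_divide[of 0, simplified])
  thus "exp (torsion 1) + 1 / exp (torsion 1) = 1" "exp (torsion 1) - 1 / exp (torsion 1) = \<i> * sqrt 3"
    "exp (torsion 2) + 1 / exp (torsion 2) = - 1" "exp (torsion 2) - 1 / exp (torsion 2) = \<i> * sqrt 3"
    unfolding exp_torsion_1 exp_torsion_2 by (simp_all add: complex_eq_iff)
qed (simp add: exp_torsion_3)

lemma norm_exp_torsion: "norm (exp (torsion k)) = 1"
  by simp

lemma lambert_power_sums:
  assumes "norm q < 1" "k > 0"
  shows "(\<lambda>n. of_nat (Suc n) * ((q ^ Suc n) ^ k / (1 - (q ^ Suc n) ^ k))) sums lambert (q ^ k)"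
proof -
  have "norm (q ^ k) < 1" using assms by (simp add: norm_power power_less_one_iff)
  from euler_prod_logderiv(2)[OF this] show ?thesis
    by (simp only: power_mult[symmetric] mult.commute)
qed

text \<open>
Logarithmic derivatives of cyclotomic factorisations: at a primitive root of unity of order 1, 2, 3 or 6
the factor \<open>1 - (z + 1 / z) x + x\<^sup>2\<close> is \<open>(1 - x)\<^sup>2\<close>, \<open>((1 - x\<^sup>2) / (1 - x))\<^sup>2\<close>, \<open>(1 - x\<^sup>3) / (1 - x)\<close> or
\<open>(1 - x\<^sup>6) (1 - x) / ((1 - x\<^sup>2) (1 - x\<^sup>3))\<close>.
\<close>

lemma qheat_lambert:
  assumes w: "Re w < 0"
  defines "q \<equiv> exp w"
  shows "qheat 0 w = - 2 * lambert q"
    and "qheat (torsion 1) w = - 6 * lambert (q ^ 6) + 3 * lambert (q ^ 3) + 2 * lambert (q\<^sup>2) - lambert q"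
    and "qheat (torsion 2) w = - 3 * lambert (q ^ 3) + lambert q"
    and "qheat (torsion 3) w = - 4 * lambert (q\<^sup>2) + 2 * lambert q"
proof -
  have q: "norm q < 1" using w by (simp add: q_def)
  define x where "x n = q ^ Suc n" for n
  have x: "norm (x n) < 1" for n using q by (simp add: x_def norm_power power_less_one_iff del: power_Suc)
  define \<phi> where "\<phi> k n = of_nat (Suc n) * (x n ^ k / (1 - x n ^ k))" for k n
  have \<phi>: "\<phi> k sums lambert (q ^ k)" if "k > 0" for k
    unfolding \<phi>_def x_def by (rule lambert_power_sums[OF q that])
  have S: "(\<lambda>n. of_nat (Suc n) * (((exp v + 1 / exp v) * x n - 2 * (x n)\<^sup>2) /
      (1 - (exp v + 1 / exp v) * x n + (x n)\<^sup>2))) sums (- qheat v w)" if v: "Re v = 0" for v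
  proof -
    have "norm (exp v) = 1" using v by simp
    note eq = geometric_pair_sum(1)[OF this x, unfolded x_def q_def]
    show ?thesis
      using qheat_sums[of v w] v w unfolding eq x_def q_def by simp
  qed
  have fac: "1 - y ^ 3 = (1 - y) * (1 + y + y\<^sup>2)" "1 - y ^ 6 = (1 - y) * (1 + y) * (1 + y + y\<^sup>2) * (1 - y + y\<^sup>2)"
    "1 - y\<^sup>2 = (1 - y) * (1 + y)"
    for y :: complex by algebra+
  {
    have "(\<lambda>n. of_nat (Suc n) * ((2 * x n - 2 * (x n)\<^sup>2) / (1 - 2 * x n + (x n)\<^sup>2))) = (\<lambda>n. 2 * \<phi> 1 n)"
    proof
      fix n
      have "(2 * x n - 2 * (x n)\<^sup>2) = 2 * x n * (1 - x n)" "1 - 2 * x n + (x n)\<^sup>2 = (1 - x n) * (1 - x n)"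
        by algebra+
      thus "of_nat (Suc n) * ((2 * x n - 2 * (x n)\<^sup>2) / (1 - 2 * x n + (x n)\<^sup>2)) = 2 * \<phi> 1 n"
        unfolding \<phi>_def using cyclotomic_nonzero(1)[OF x[of n]] by simp
    qed
    moreover have "(\<lambda>n. 2 * \<phi> 1 n) sums (2 * lambert (q ^ 1))"
      by (intro sums_mult \<phi>) simp
    ultimately have "- qheat 0 w = 2 * lambert (q ^ 1)"
      using sums_unique2[OF S[of 0]] by simp
    hence "qheat 0 w = - (2 * lambert q)" by (metis minus_minus power_one_right)
    thus "qheat 0 w = - 2 * lambert q" by simp
  }
  {
    have "(\<lambda>n. of_nat (Suc n) * ((1 * x n - 2 * (x n)\<^sup>2) / (1 - 1 * x n + (x n)\<^sup>2))) =
        (\<lambda>n. 6 * \<phi> 6 n - 3 * \<phi> 3 n - 2 * \<phi> 2 n + \<phi> 1 n)"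
    proof
      fix n
      show "of_nat (Suc n) * ((1 * x n - 2 * (x n)\<^sup>2) / (1 - 1 * x n + (x n)\<^sup>2)) =
          6 * \<phi> 6 n - 3 * \<phi> 3 n - 2 * \<phi> 2 n + \<phi> 1 n"
      proof -
        define y where "y = x n"
        note nz = cyclotomic_nonzero[OF x[of n], folded y_def]
        have "(1 * y - 2 * y\<^sup>2) / (1 - 1 * y + y\<^sup>2) =
           6 * (y ^ 6 / (1 - y ^ 6)) - 3 * (y ^ 3 / (1 - y ^ 3)) - 2 * (y\<^sup>2 / (1 - y\<^sup>2)) + y ^ 1 / (1 - y ^ 1)"
          unfolding fac using nz by (simp add: divide_simps) algebra
        thus ?thesis
          unfolding \<phi>_def y_def[symmetric] by (simp only: distrib_left right_diff_distrib mult.left_commute)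
      qed
    qed
    moreover have "(\<lambda>n. 6 * \<phi> 6 n - 3 * \<phi> 3 n - 2 * \<phi> 2 n + \<phi> 1 n) sums
        (6 * lambert (q ^ 6) - 3 * lambert (q ^ 3) - 2 * lambert (q ^ 2) + lambert (q ^ 1))"
      by (intro sums_add sums_diff sums_mult \<phi>) simp_all
    ultimately have "- qheat (torsion 1) w =
        6 * lambert (q ^ 6) - 3 * lambert (q ^ 3) - 2 * lambert (q ^ 2) + lambert (q ^ 1)"
      using sums_unique2[OF S[of "torsion 1", unfolded torsion_trace]] by simp
    thus "qheat (torsion 1) w = - 6 * lambert (q ^ 6) + 3 * lambert (q ^ 3) + 2 * lambert (q\<^sup>2) - lambert q"
      by (simp add: minus_equation_iff algebra_simps)
  }
  {
    have "(\<lambda>n. of_nat (Suc n) * ((- 1 * x n - 2 * (x n)\<^sup>2) / (1 - - 1 * x n + (x n)\<^sup>2))) =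
        (\<lambda>n. 3 * \<phi> 3 n - \<phi> 1 n)"
    proof
      fix n
      show "of_nat (Suc n) * ((- 1 * x n - 2 * (x n)\<^sup>2) / (1 - - 1 * x n + (x n)\<^sup>2)) = 3 * \<phi> 3 n - \<phi> 1 n"
      proof -
        define y where "y = x n"
        note nz = cyclotomic_nonzero[OF x[of n], folded y_def]
        have "(- 1 * y - 2 * y\<^sup>2) / (1 - - 1 * y + y\<^sup>2) = 3 * (y ^ 3 / (1 - y ^ 3)) - y ^ 1 / (1 - y ^ 1)"
          unfolding fac using nz by (simp add: divide_simps) algebra
        thus ?thesis
          unfolding \<phi>_def y_def[symmetric] by (simp only: distrib_left right_diff_distrib mult.left_commute)
      qed
    qed
    moreover have "(\<lambda>n. 3 * \<phi> 3 n - \<phi> 1 n) sums (3 * lambert (q ^ 3) - lambert (q ^ 1))"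
      by (intro sums_diff sums_mult \<phi>) simp_all
    ultimately have "- qheat (torsion 2) w = 3 * lambert (q ^ 3) - lambert (q ^ 1)"
      using sums_unique2[OF S[of "torsion 2", unfolded torsion_trace]] by simp
    hence "qheat (torsion 2) w = - (3 * lambert (q ^ 3) - lambert (q ^ 1))" by (metis minus_minus)
    thus "qheat (torsion 2) w = - 3 * lambert (q ^ 3) + lambert q" by simp
  }
  {
    have "(\<lambda>n. of_nat (Suc n) * ((- 2 * x n - 2 * (x n)\<^sup>2) / (1 - - 2 * x n + (x n)\<^sup>2))) =
        (\<lambda>n. 4 * \<phi> 2 n - 2 * \<phi> 1 n)"
    proof
      fix n
      show "of_nat (Suc n) * ((- 2 * x n - 2 * (x n)\<^sup>2) / (1 - - 2 * x n + (x n)\<^sup>2)) = 4 * \<phi> 2 n - 2 * \<phi> 1 n"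
      proof -
        define y where "y = x n"
        note nz = cyclotomic_nonzero[OF x[of n], folded y_def]
        have den: "1 - - 2 * y + y\<^sup>2 = (1 + y) * (1 + y)" by algebra
        have "(- 2 * y - 2 * y\<^sup>2) / (1 - - 2 * y + y\<^sup>2) = 4 * (y\<^sup>2 / (1 - y\<^sup>2)) - 2 * (y ^ 1 / (1 - y ^ 1))"
          unfolding fac den using nz by (simp add: divide_simps) algebra
        thus ?thesis
          unfolding \<phi>_def y_def[symmetric] by (simp only: distrib_left right_diff_distrib mult.left_commute)
      qed
    qed
    moreover have "(\<lambda>n. 4 * \<phi> 2 n - 2 * \<phi> 1 n) sums (4 * lambert (q ^ 2) - 2 * lambert (q ^ 1))"
      by (intro sums_diff sums_mult \<phi>) simp_all
    ultimately have "- qheat (torsion 3) w = 4 * lambert (q ^ 2) - 2 * lambert (q ^ 1)"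
      using sums_unique2[OF S[of "torsion 3", unfolded torsion_trace]] by simp
    hence "qheat (torsion 3) w = - (4 * lambert (q ^ 2) - 2 * lambert (q ^ 1))" by (metis minus_minus)
    thus "qheat (torsion 3) w = - 4 * lambert (q\<^sup>2) + 2 * lambert q" by simp
  }
qed

section \<open>The eta quotients and the weight one forms\<close>

lemma has_logderiv_mult:
  assumes "(f has_field_derivative f z * a) (at z)" "(g has_field_derivative g z * b) (at (z :: complex))"
  shows "((\<lambda>x. f x * g x) has_field_derivative f z * g z * (a + b)) (at z)"
  by (rule derivative_eq_intros assms refl)+ (simp add: algebra_simps)

lemma has_logderiv_divide:
  assumes "(f has_field_derivative f z * a) (at z)" "(g has_field_derivative g z * b) (at (z :: complex))" "g z \<noteq> 0"
  shows "((\<lambda>x. f x / g x) has_field_derivative f z / g z * (a - b)) (at z)"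
  by (rule derivative_eq_intros assms refl)+ (use assms(3) in \<open>simp add: field_simps\<close>)

lemma has_logderiv_power:
  assumes "(f has_field_derivative f z * a) (at (z :: complex))"
  shows "((\<lambda>x. f x ^ n) has_field_derivative f z ^ n * (of_nat n * a)) (at z)"
proof (cases n)
  case (Suc m)
  show ?thesis
    by (rule derivative_eq_intros assms refl)+ (simp add: Suc algebra_simps)
qed auto

definition level6_t :: "complex \<Rightarrow> complex" where
  "level6_t w = (eta_exp w ^ 4 * eta_exp (6 * w) ^ 8) / (eta_exp (2 * w) ^ 8 * eta_exp (3 * w) ^ 4)"

definition level6_T :: "complex \<Rightarrow> complex" where
  "level6_T w = (eta_exp (2 * w) ^ 6 * eta_exp (3 * w)) / (eta_exp w ^ 3 * eta_exp (6 * w) ^ 2)"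

lemma heun_t_conv: "heun_t \<tau> = level6_t (of_real pi * \<i> * \<tau>)"
  by (simp add: heun_t_def level6_t_def dedekind_eta_conv_eta_exp mult_ac)

lemma heun_T_conv: "heun_T \<tau> = level6_T (of_real pi * \<i> * \<tau>)"
  by (simp add: heun_T_def level6_T_def dedekind_eta_conv_eta_exp mult_ac)

lemma eta_exp_scaled_deriv:
  assumes "Re w < 0" "k > 0"
  shows "((\<lambda>w. eta_exp (of_nat k * w)) has_field_derivative
           eta_exp (of_nat k * w) * (of_nat k * eta_logderiv (of_nat k * w))) (at w)"
proof -
  have "Re (of_nat k * w) < 0" using assms by (simp add: mult_pos_neg)
  from DERIV_chain2[where f = eta_exp and g = "\<lambda>w. of_nat k * w", OF eta_exp_deriv[OF this] DERIV_cmult_Id]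
  show ?thesis by (simp add: mult_ac)
qed

text \<open>
The last three left-hand sides are the logarithmic derivatives of \<open>\<eta>\<^sub>6 \<eta>\<^sub>1 / (\<eta>\<^sub>2 \<eta>\<^sub>3)\<close>, \<open>\<eta>\<^sub>3 / \<eta>\<^sub>1\<close>
and \<open>(\<eta>\<^sub>2 / \<eta>\<^sub>1)\<^sup>2\<close>, where \<open>\<eta>\<^sub>k\<close> is the eta function at \<open>k w\<close>. Up to powers of \<open>q\<close> these quotients are
the values of the theta product at the points of order 6, 3 and 2, and the powers of \<open>q\<close> account for
the difference \<open>1/12\<close> from \<open>qheat\<close>.
\<close>

lemma eta_logderiv_levels:
  assumes w: "Re w < 0"
  defines "a \<equiv> alpha w" and "b \<equiv> beta w"
  shows "eta_logderiv w = kappa w / 2"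
    and "6 * eta_logderiv (6 * w) - 3 * eta_logderiv (3 * w) - 2 * eta_logderiv (2 * w) + eta_logderiv w =
           - a\<^sup>2 / 2 + a * b + b\<^sup>2 / 2"
    and "3 * eta_logderiv (3 * w) - eta_logderiv w = - b\<^sup>2"
    and "4 * eta_logderiv (2 * w) - 2 * eta_logderiv w = a\<^sup>2 / 2 - 2 * a * b + b\<^sup>2 / 2"
proof -
  note L = qheat_lambert[OF w] and S = qheat_torsion[OF w, folded a_def b_def]
  have e: "exp (2 * w) = exp w ^ 2" "exp (3 * w) = exp w ^ 3" "exp (6 * w) = exp w ^ 6"
    using exp_of_nat_mult[of 2 w] exp_of_nat_mult[of 3 w] exp_of_nat_mult[of 6 w] by simp_all
  show "eta_logderiv w = kappa w / 2"
    by (simp add: eta_logderiv_def kappa_def L)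
  have "6 * eta_logderiv (6 * w) - 3 * eta_logderiv (3 * w) - 2 * eta_logderiv (2 * w) + eta_logderiv w = qheat (torsion 1) w + 1 / 12"
    unfolding eta_logderiv_def e L by (simp add: algebra_simps)
  also have "\<dots> =
           - a\<^sup>2 / 2 + a * b + b\<^sup>2 / 2"
    unfolding S by simp
  finally show "6 * eta_logderiv (6 * w) - 3 * eta_logderiv (3 * w) - 2 * eta_logderiv (2 * w) + eta_logderiv w =
           - a\<^sup>2 / 2 + a * b + b\<^sup>2 / 2" .
  have "3 * eta_logderiv (3 * w) - eta_logderiv w = qheat (torsion 2) w + 1 / 12"
    unfolding eta_logderiv_def e L by (simp add: algebra_simps)
  also have "\<dots> = - b\<^sup>2"
    unfolding S by simp
  finally show "3 * eta_logderiv (3 * w) - eta_logderiv w = - b\<^sup>2" .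
  have "4 * eta_logderiv (2 * w) - 2 * eta_logderiv w = qheat (torsion 3) w + 1 / 12"
    unfolding eta_logderiv_def e L by (simp add: algebra_simps)
  also have "\<dots> = a\<^sup>2 / 2 - 2 * a * b + b\<^sup>2 / 2"
    unfolding S by simp
  finally show "4 * eta_logderiv (2 * w) - 2 * eta_logderiv w = a\<^sup>2 / 2 - 2 * a * b + b\<^sup>2 / 2" .
qed

definition T_logderiv :: "complex \<Rightarrow> complex" where
  "T_logderiv w = 2 * alpha w ^ 2 - 6 * alpha w * beta w + beta w ^ 2 + kappa w"

text \<open>
With \<open>\<theta>\<^sub>k\<close> the values of the theta product at the multiples \<open>k\<close> of the point of order 6, one has
\<open>t = q \<theta>\<^sub>1\<^sup>8 \<theta>\<^sub>2\<^sup>4\<close> and, with \<open>E = \<Prod>(1 - q\<^sup>m)\<close>, \<open>T = \<theta>\<^sub>3\<^sup>2 E\<^sup>2 / (\<theta>\<^sub>1\<^sup>2 \<theta>\<^sub>2)\<close>. These exponents are the coefficients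
in the two regroupings below.
\<close>

lemma level6_deriv:
  assumes w: "Re w < 0"
  shows "(level6_t has_field_derivative level6_t w * (4 * alpha w * (2 * beta w - alpha w))) (at w)"
    and "(level6_T has_field_derivative level6_T w * T_logderiv w) (at w)"
    and "level6_t w \<noteq> 0" "level6_T w \<noteq> 0"
proof -
  note d = eta_exp_deriv[OF w] eta_exp_scaled_deriv[OF w, of 2, simplified]
    eta_exp_scaled_deriv[OF w, of 3, simplified] eta_exp_scaled_deriv[OF w, of 6, simplified]
  have nz: "eta_exp w \<noteq> 0" "eta_exp (2 * w) \<noteq> 0" "eta_exp (3 * w) \<noteq> 0" "eta_exp (6 * w) \<noteq> 0"
    using w by (simp_all add: eta_exp_nonzero)
  show "level6_t w \<noteq> 0" "level6_T w \<noteq> 0"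
    using nz by (simp_all add: level6_t_def level6_T_def)
  note M = eta_logderiv_levels[OF w]
  define m1 m2 m3 m6 where "m1 = eta_logderiv w" and "m2 = eta_logderiv (2 * w)"
    and "m3 = eta_logderiv (3 * w)" and "m6 = eta_logderiv (6 * w)"
  note M' = M[folded m1_def m2_def m3_def m6_def]
  have "(level6_t has_field_derivative level6_t w *
      (of_nat 4 * m1 + of_nat 8 * (6 * m6) - (of_nat 8 * (2 * m2) + of_nat 4 * (3 * m3)))) (at w)"
    unfolding level6_t_def[abs_def] m1_def m2_def m3_def m6_def
    by (intro has_logderiv_divide has_logderiv_mult has_logderiv_power d) (use nz in simp)
  also have "of_nat 4 * m1 + of_nat 8 * (6 * m6) - (of_nat 8 * (2 * m2) + of_nat 4 * (3 * m3)) =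
      8 * (6 * m6 - 3 * m3 - 2 * m2 + m1) + 4 * (3 * m3 - m1)"
    by (simp add: algebra_simps)
  also have "\<dots> = 4 * alpha w * (2 * beta w - alpha w)"
    unfolding M'(2,3) by (simp add: field_simps power2_eq_square)
  finally show "(level6_t has_field_derivative level6_t w * (4 * alpha w * (2 * beta w - alpha w))) (at w)" .
  have "(level6_T has_field_derivative level6_T w *
      (of_nat 6 * (2 * m2) + 3 * m3 - (of_nat 3 * m1 + of_nat 2 * (6 * m6)))) (at w)"
    unfolding level6_T_def[abs_def] m1_def m2_def m3_def m6_def
    by (intro has_logderiv_divide has_logderiv_mult has_logderiv_power d) (use nz in simp)
  also have "of_nat 6 * (2 * m2) + 3 * m3 - (of_nat 3 * m1 + of_nat 2 * (6 * m6)) =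
      2 * (4 * m2 - 2 * m1) - 2 * (6 * m6 - 3 * m3 - 2 * m2 + m1) - (3 * m3 - m1) + 2 * m1"
    by (simp add: algebra_simps)
  also have "\<dots> = T_logderiv w"
    unfolding M'(2-4) unfolding M'(1) T_logderiv_def by (simp add: field_simps power2_eq_square)
  finally show "(level6_T has_field_derivative level6_T w * T_logderiv w) (at w)" .
qed

lemma T_logderiv_deriv:
  assumes w: "Re w < 0"
  defines "a \<equiv> alpha w" and "b \<equiv> beta w"
  shows "(T_logderiv has_field_derivative
     T_logderiv w ^ 2 - 6 * a * (a - b) * (a - 2 * b) * (a - 3 * b)) (at w)"
proof -
  define k where "k = kappa w"
  have "(T_logderiv has_field_derivative
      4 * a * (a * (a ^ 2 - a * b - 5 * b ^ 2 + k)) -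
      6 * (a * (a ^ 3 - 3 * a ^ 2 * b + b ^ 3 + k * b) + (a * (a ^ 2 - a * b - 5 * b ^ 2 + k)) * b) +
      2 * b * (a ^ 3 - 3 * a ^ 2 * b + b ^ 3 + k * b) +
      (k ^ 2 - 9 * b ^ 4 + 2 * b * (a + b) * (a - 2 * b)\<^sup>2)) (at w)"
    unfolding T_logderiv_def[abs_def] a_def b_def k_def
    by (rule derivative_eq_intros alpha_deriv beta_deriv kappa_deriv w refl)+
       (simp add: power2_eq_square distrib_right mult_ac)
  also have "4 * a * (a * (a ^ 2 - a * b - 5 * b ^ 2 + k)) -
      6 * (a * (a ^ 3 - 3 * a ^ 2 * b + b ^ 3 + k * b) + (a * (a ^ 2 - a * b - 5 * b ^ 2 + k)) * b) +
      2 * b * (a ^ 3 - 3 * a ^ 2 * b + b ^ 3 + k * b) +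
      (k ^ 2 - 9 * b ^ 4 + 2 * b * (a + b) * (a - 2 * b)\<^sup>2) =
      T_logderiv w ^ 2 - 6 * a * (a - b) * (a - 2 * b) * (a - 3 * b)"
    unfolding T_logderiv_def a_def[symmetric] b_def[symmetric] k_def[symmetric] by algebra
  finally show ?thesis .
qed

lemma logderiv_ratio_const:
  assumes f: "\<And>w. Re w < 0 \<Longrightarrow> (f has_field_derivative f w * u w) (at w)"
    and g: "\<And>w. Re w < 0 \<Longrightarrow> (g has_field_derivative g w * u w) (at w)" "\<And>w. Re w < 0 \<Longrightarrow> g w \<noteq> 0"
  obtains C where "\<And>w. Re w < 0 \<Longrightarrow> f w = C * g w"
proof -
  have *: "((\<lambda>w. f w / g w) has_field_derivative 0) (at w within {w. Re w < 0})" if "w \<in> {w. Re w < 0}" for w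
    using has_logderiv_divide[OF f g, of w] that by (auto intro: has_field_derivative_at_within)
  have "\<exists>C. \<forall>w\<in>{w. Re w < 0}. f w / g w = C"
    by (rule has_field_derivative_zero_constant[OF convex_halfspace_Re_lt *])
  then obtain C where C: "\<And>w. Re w < 0 \<Longrightarrow> f w / g w = C"
    by blast
  have "f w = C * g w" if "Re w < 0" for w
    using C[OF that] g(2)[OF that] by (simp add: divide_eq_eq)
  thus thesis by (rule that)
qed

text \<open>
Both sides of each equation satisfy the same first order linear differential equation.
\<close>

lemma weight1_ratio:
  obtains C1 C2 where "\<And>w. Re w < 0 \<Longrightarrow> alpha w + beta w = C1 * level6_T w"
    "\<And>w. Re w < 0 \<Longrightarrow> alpha w - 3 * beta w = C2 * (level6_t w * level6_T w)"
proof -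
  have 1: "((\<lambda>w. alpha w + beta w) has_field_derivative (alpha w + beta w) * T_logderiv w) (at w)"
    if w: "Re w < 0" for w
    unfolding T_logderiv_def
    by (rule derivative_eq_intros alpha_deriv beta_deriv w refl)+ algebra
  obtain C1 where C1: "\<And>w. Re w < 0 \<Longrightarrow> alpha w + beta w = C1 * level6_T w"
    using logderiv_ratio_const[OF 1 level6_deriv(2,4)] by blast
  have 2: "((\<lambda>w. alpha w - 3 * beta w) has_field_derivative
      (alpha w - 3 * beta w) * (4 * alpha w * (2 * beta w - alpha w) + T_logderiv w)) (at w)"
    if w: "Re w < 0" for w
    unfolding T_logderiv_def
    by (rule derivative_eq_intros alpha_deriv beta_deriv w refl)+ algebra
  have 3: "((\<lambda>w. level6_t w * level6_T w) has_field_derivative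
      level6_t w * level6_T w * (4 * alpha w * (2 * beta w - alpha w) + T_logderiv w)) (at w)"
    if w: "Re w < 0" for w
    by (intro has_logderiv_mult level6_deriv w)
  obtain C2 where C2: "\<And>w. Re w < 0 \<Longrightarrow> alpha w - 3 * beta w = C2 * (level6_t w * level6_T w)"
    using logderiv_ratio_const[OF 2 3] level6_deriv(3,4) by (metis mult_eq_0_iff)
  from C1 C2 show thesis by (rule that)
qed

section \<open>Behaviour at the cusp\<close>

text \<open>
As \<open>q\<close> tends to \<open>0\<close>, only the first term of the series survives division by \<open>q\<close>.
\<close>

lemma lambert_type_limit:
  fixes k F :: "complex \<Rightarrow> complex"
  assumes cont: "continuous_on (cball 0 (1 / 2)) k"
    and sums: "\<And>q. q \<noteq> 0 \<Longrightarrow> norm q \<le> 1 / 2 \<Longrightarrow> (\<lambda>n. q ^ Suc n * k (q ^ Suc n)) sums F q"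
  shows "((\<lambda>q. F q / q) \<longlongrightarrow> k 0) (at 0)"
proof -
  have "bounded (k ` cball 0 (1 / 2))"
    using cont compact_continuous_image compact_cball compact_imp_bounded by blast
  then obtain K where "\<forall>y\<in>k ` cball 0 (1 / 2). norm y \<le> K"
    unfolding bounded_iff by blast
  hence K: "norm (k x) \<le> K" if "norm x \<le> 1 / 2" for x
    using that by auto
  have K0: "K \<ge> 0" using order_trans[OF norm_ge_zero K[of 0]] by simp
  have bound: "norm (F q / q - k q) \<le> 2 * K * norm q" if q: "q \<noteq> 0" "norm q \<le> 1 / 2" for q
  proof -
    have "(\<lambda>n. q ^ Suc (Suc n) * k (q ^ Suc (Suc n))) sums (F q - q * k q)"
      using sums[OF q] by (subst sums_Suc_iff) simp
    moreover have "(\<lambda>n. K * (norm q)\<^sup>2 * norm q ^ n) sums (K * (norm q)\<^sup>2 * (1 / (1 - norm q)))"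
      by (intro sums_mult geometric_sums) (use q in auto)
    moreover have "norm (q ^ Suc (Suc n) * k (q ^ Suc (Suc n))) \<le> K * (norm q)\<^sup>2 * norm q ^ n" for n
    proof -
      have "norm (q ^ Suc (Suc n)) \<le> norm q ^ 1"
        unfolding norm_power using q by (intro power_decreasing) auto
      hence "norm (k (q ^ Suc (Suc n))) \<le> K" using q by (intro K) auto
      hence "norm (q ^ Suc (Suc n)) * norm (k (q ^ Suc (Suc n))) \<le> norm (q ^ Suc (Suc n)) * K"
        by (intro mult_left_mono) auto
      thus ?thesis by (simp add: norm_mult norm_power power2_eq_square mult_ac)
    qed
    ultimately have "norm (F q - q * k q) \<le> K * (norm q)\<^sup>2 * (1 / (1 - norm q))"
      by (rule norm_sums_le)
    also have "\<dots> \<le> K * (norm q)\<^sup>2 * 2"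
      using q K0 by (intro mult_left_mono) (auto simp: field_simps)
    finally have "norm (F q - q * k q) / norm q \<le> K * (norm q)\<^sup>2 * 2 / norm q"
      by (intro divide_right_mono) auto
    also have "norm (F q - q * k q) / norm q = norm (F q / q - k q)"
      using q by (simp add: norm_divide[symmetric] diff_divide_distrib)
    also have "K * (norm q)\<^sup>2 * 2 / norm q = 2 * K * norm q"
      using q by (simp add: power2_eq_square)
    finally show ?thesis .
  qed
  have "((\<lambda>q. F q / q - k q) \<longlongrightarrow> 0) (at 0)"
  proof (rule Lim_null_comparison)
    have "eventually (\<lambda>q::complex. q \<in> ball 0 (1 / 2) - {0}) (at 0)"
      by (rule eventually_at_in_open) auto
    thus "eventually (\<lambda>q. norm (F q / q - k q) \<le> 2 * K * norm q) (at 0)"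
      by eventually_elim (use bound in auto)
    show "((\<lambda>q::complex. 2 * K * norm q) \<longlongrightarrow> 0) (at 0)"
      by (auto intro!: tendsto_eq_intros)
  qed
  moreover have "(k \<longlongrightarrow> k 0) (at 0)"
  proof -
    have "isCont k 0"
      using cont by (rule continuous_on_interior) (simp add: interior_cball)
    thus ?thesis by (simp add: isCont_def)
  qed
  ultimately have "((\<lambda>q. F q / q - k q + k q) \<longlongrightarrow> 0 + k 0) (at 0)"
    by (rule tendsto_add)
  thus ?thesis by simp
qed

lemma half_coth_torsion:
  "half_coth (torsion 1) = \<i> * sqrt 3 / 2" "half_coth (torsion 2) = \<i> * sqrt 3 / 6"
proof -
  have *: "half_coth u = c" if "1 + exp u = c * (2 * (1 - exp u))" "exp u \<noteq> 1" for u c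
    using that by (simp add: half_coth_def field_simps)
  show "half_coth (torsion 1) = \<i> * sqrt 3 / 2" "half_coth (torsion 2) = \<i> * sqrt 3 / 6"
    by (rule *; simp only: exp_torsion_1 exp_torsion_2; simp add: complex_eq_iff field_simps)+
qed

lemma alpha_beta_sums:
  assumes q: "q \<noteq> 0" "norm q < 1"
  shows "(\<lambda>n. q ^ Suc n * (\<i> * sqrt 3 / (1 - q ^ Suc n + (q ^ Suc n)\<^sup>2))) sums (alpha (Ln q) - \<i> * sqrt 3 / 2)"
    and "(\<lambda>n. q ^ Suc n * (\<i> * sqrt 3 / (1 + q ^ Suc n + (q ^ Suc n)\<^sup>2))) sums (beta (Ln q) - \<i> * sqrt 3 / 6)"
proof -
  have "Re (Ln q) < 0" using q by simp
  hence str: "\<bar>Re (torsion k)\<bar> < - Re (Ln q)" for k by simp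
  have x: "norm (q ^ Suc n) < 1" for n
    using q by (simp add: norm_power power_less_one_iff del: power_Suc)
  note eq = geometric_pair_sum(2)[OF norm_exp_torsion x]
  show "(\<lambda>n. q ^ Suc n * (\<i> * sqrt 3 / (1 - q ^ Suc n + (q ^ Suc n)\<^sup>2))) sums (alpha (Ln q) - \<i> * sqrt 3 / 2)"
    using qzeta_sums[OF str, of 1] unfolding exp_Ln[OF q(1)] eq torsion_trace half_coth_torsion alpha_def
    by (simp only: mult_1_left mult_1_right times_divide_eq_right mult.commute)
  show "(\<lambda>n. q ^ Suc n * (\<i> * sqrt 3 / (1 + q ^ Suc n + (q ^ Suc n)\<^sup>2))) sums (beta (Ln q) - \<i> * sqrt 3 / 6)"
    using qzeta_sums[OF str, of 2] unfolding exp_Ln[OF q(1)] eq torsion_trace half_coth_torsion beta_def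
    by (simp only: mult_minus1 diff_minus_eq_add times_divide_eq_right mult.commute)
qed

text \<open>
The constant terms of \<open>\<alpha>\<close> and \<open>3 \<beta>\<close> agree, so \<open>\<alpha> - 3 \<beta>\<close> vanishes at the cusp like \<open>t T\<close>, and its limit
after division by \<open>q\<close> is needed.
\<close>

lemma alpha_beta_limits:
  shows "((\<lambda>q. alpha (Ln q) + beta (Ln q)) \<longlongrightarrow> 2 * \<i> * sqrt 3 / 3) (at 0)"
    and "((\<lambda>q. (alpha (Ln q) - 3 * beta (Ln q)) / q) \<longlongrightarrow> - 2 * \<i> * sqrt 3) (at 0)"
proof -
  define F1 F2 where "F1 = (\<lambda>q. alpha (Ln q) - \<i> * sqrt 3 / 2)" and "F2 = (\<lambda>q. beta (Ln q) - \<i> * sqrt 3 / 6)"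
  have nz: "1 - x + x\<^sup>2 \<noteq> 0" "1 + x + x\<^sup>2 \<noteq> 0" if "x \<in> cball 0 (1 / 2)" for x :: complex
    using cyclotomic_nonzero[of x] that by auto
  have "((\<lambda>q. F1 q / q) \<longlongrightarrow> \<i> * sqrt 3 / (1 - 0 + 0\<^sup>2)) (at 0)"
    unfolding F1_def
  proof (rule lambert_type_limit[where k = "\<lambda>x. \<i> * sqrt 3 / (1 - x + x\<^sup>2)"])
    show "continuous_on (cball 0 (1 / 2)) (\<lambda>x. \<i> * complex_of_real (sqrt 3) / (1 - x + x\<^sup>2))"
      using nz by (intro continuous_intros) auto
  qed (rule alpha_beta_sums(1), auto)
  hence 1: "((\<lambda>q. F1 q / q) \<longlongrightarrow> \<i> * sqrt 3) (at 0)" by simp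
  have "((\<lambda>q. F2 q / q) \<longlongrightarrow> \<i> * sqrt 3 / (1 + 0 + 0\<^sup>2)) (at 0)"
    unfolding F2_def
  proof (rule lambert_type_limit[where k = "\<lambda>x. \<i> * sqrt 3 / (1 + x + x\<^sup>2)"])
    show "continuous_on (cball 0 (1 / 2)) (\<lambda>x. \<i> * complex_of_real (sqrt 3) / (1 + x + x\<^sup>2))"
      using nz by (intro continuous_intros) auto
  qed (rule alpha_beta_sums(2), auto)
  hence 2: "((\<lambda>q. F2 q / q) \<longlongrightarrow> \<i> * sqrt 3) (at 0)" by simp
  have ne: "eventually (\<lambda>q::complex. q \<noteq> 0) (at 0)"
    by (simp add: eventually_at_filter)
  have "((\<lambda>q. 2 * \<i> * sqrt 3 / 3 + q * (F1 q / q + F2 q / q)) \<longlongrightarrow>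
      2 * \<i> * sqrt 3 / 3 + 0 * (\<i> * sqrt 3 + \<i> * sqrt 3)) (at 0)"
    by (intro tendsto_intros 1 2)
  moreover have "eventually (\<lambda>q. 2 * \<i> * sqrt 3 / 3 + q * (F1 q / q + F2 q / q) =
      alpha (Ln q) + beta (Ln q)) (at 0)"
    using ne by eventually_elim (simp add: F1_def F2_def distrib_left field_simps)
  ultimately show "((\<lambda>q. alpha (Ln q) + beta (Ln q)) \<longlongrightarrow> 2 * \<i> * sqrt 3 / 3) (at 0)"
    by (simp add: tendsto_cong)
  have "((\<lambda>q. F1 q / q - 3 * (F2 q / q)) \<longlongrightarrow> \<i> * sqrt 3 - 3 * (\<i> * sqrt 3)) (at 0)"
    by (intro tendsto_intros 1 2)
  moreover have "F1 q / q - 3 * (F2 q / q) = (alpha (Ln q) - 3 * beta (Ln q)) / q" for q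
    by (cases "q = 0") (simp_all add: F1_def F2_def field_simps)
  ultimately show "((\<lambda>q. (alpha (Ln q) - 3 * beta (Ln q)) / q) \<longlongrightarrow> - 2 * \<i> * sqrt 3) (at 0)"
    by (simp add: mult.assoc)
qed

text \<open>
The exponential factors of the eta functions contribute \<open>q\<close> to the power \<open>(4 + 48 - 16 - 12) / 24 = 1\<close>
in \<open>t\<close> and \<open>(12 + 3 - 3 - 12) / 24 = 0\<close> in \<open>T\<close>.
\<close>

lemma level6_q:
  defines "E \<equiv> euler_prod"
  assumes q: "q \<noteq> 0"
  shows "level6_T (Ln q) = E (q ^ 2) ^ 6 * E (q ^ 3) / (E (q ^ 1) ^ 3 * E (q ^ 6) ^ 2)"
    and "level6_t (Ln q) = q * (E (q ^ 1) ^ 4 * E (q ^ 6) ^ 8 / (E (q ^ 2) ^ 8 * E (q ^ 3) ^ 4))"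
proof -
  define w where "w = Ln q"
  define r where "r = exp (w / 24)"
  have r: "r \<noteq> 0" "r ^ 24 = q"
    using q by (simp_all add: r_def w_def exp_of_nat_mult[symmetric])
  have e: "eta_exp (of_nat k * w) = r ^ k * E (q ^ k)" for k
    using q by (simp add: eta_exp_def r_def w_def E_def exp_of_nat_mult[symmetric] exp_of_nat_mult)
  have e': "eta_exp w = r ^ 1 * E (q ^ 1)" "eta_exp (2 * w) = r ^ 2 * E (q ^ 2)"
    "eta_exp (3 * w) = r ^ 3 * E (q ^ 3)" "eta_exp (6 * w) = r ^ 6 * E (q ^ 6)"
    using e[of 1] e[of 2] e[of 3] e[of 6] by simp_all
  have "level6_T w = (r ^ 15 * (E (q ^ 2) ^ 6 * E (q ^ 3))) / (r ^ 15 * (E (q ^ 1) ^ 3 * E (q ^ 6) ^ 2))"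
    unfolding level6_T_def e' by (rule arg_cong2[where f = "(/)"]) algebra+
  thus "level6_T (Ln q) = E (q ^ 2) ^ 6 * E (q ^ 3) / (E (q ^ 1) ^ 3 * E (q ^ 6) ^ 2)"
    using r(1) by (simp add: w_def)
  have "level6_t w = (r ^ 28 * (r ^ 24 * (E (q ^ 1) ^ 4 * E (q ^ 6) ^ 8))) / (r ^ 28 * (E (q ^ 2) ^ 8 * E (q ^ 3) ^ 4))"
    unfolding level6_t_def e' by (rule arg_cong2[where f = "(/)"]) algebra+
  thus "level6_t (Ln q) = q * (E (q ^ 1) ^ 4 * E (q ^ 6) ^ 8 / (E (q ^ 2) ^ 8 * E (q ^ 3) ^ 4))"
    using r by (simp add: w_def)
qed

lemma level6_limits:
  shows "((\<lambda>q. level6_T (Ln q)) \<longlongrightarrow> 1) (at 0)"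
    and "((\<lambda>q. level6_t (Ln q) / q) \<longlongrightarrow> 1) (at 0)"
proof -
  have "isCont euler_prod 0"
    using euler_prod_logderiv(1)[of 0] by (auto intro: DERIV_isCont)
  hence E: "((\<lambda>q. euler_prod (q ^ k)) \<longlongrightarrow> 1) (at 0)" if "k > 0" for k
  proof (rule isCont_tendsto_compose[where g = euler_prod and l = 0, THEN tendsto_eq_rhs])
    show "((\<lambda>q::complex. q ^ k) \<longlongrightarrow> 0) (at 0)"
      using that by (auto intro!: tendsto_eq_intros)
  qed simp
  have ne: "eventually (\<lambda>q::complex. q \<noteq> 0) (at 0)"
    by (simp add: eventually_at_filter)
  have "((\<lambda>q. euler_prod (q ^ 2) ^ 6 * euler_prod (q ^ 3) / (euler_prod (q ^ 1) ^ 3 * euler_prod (q ^ 6) ^ 2))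
      \<longlongrightarrow> 1 ^ 6 * 1 / (1 ^ 3 * 1 ^ 2)) (at 0)"
    by (intro tendsto_intros E) auto
  moreover have "eventually (\<lambda>q. euler_prod (q ^ 2) ^ 6 * euler_prod (q ^ 3) /
      (euler_prod (q ^ 1) ^ 3 * euler_prod (q ^ 6) ^ 2) = level6_T (Ln q)) (at 0)"
    using ne by eventually_elim (rule level6_q(1)[symmetric])
  ultimately show "((\<lambda>q. level6_T (Ln q)) \<longlongrightarrow> 1) (at 0)"
    by (simp add: tendsto_cong)
  have "((\<lambda>q. euler_prod (q ^ 1) ^ 4 * euler_prod (q ^ 6) ^ 8 / (euler_prod (q ^ 2) ^ 8 * euler_prod (q ^ 3) ^ 4))
      \<longlongrightarrow> 1 ^ 4 * 1 ^ 8 / (1 ^ 8 * 1 ^ 4)) (at 0)"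
    by (intro tendsto_intros E) auto
  moreover have "eventually (\<lambda>q. euler_prod (q ^ 1) ^ 4 * euler_prod (q ^ 6) ^ 8 /
      (euler_prod (q ^ 2) ^ 8 * euler_prod (q ^ 3) ^ 4) = level6_t (Ln q) / q) (at 0)"
    using ne by eventually_elim (subst level6_q(2); simp)
  ultimately show "((\<lambda>q. level6_t (Ln q) / q) \<longlongrightarrow> 1) (at 0)"
    by (simp add: tendsto_cong)
qed

text \<open>
The two constants of \<open>weight1_ratio\<close> are \<open>2 \<i> \<surd>3 / 3\<close> and \<open>- 2 \<i> \<surd>3\<close>, by comparing both sides at the cusp.
\<close>

lemma alpha_beta_conv_level6:
  assumes w: "Re w < 0"
  shows "alpha w = \<i> * sqrt 3 / 2 * (level6_T w * (1 - level6_t w))"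
    and "beta w = \<i> * sqrt 3 / 6 * (level6_T w * (1 + 3 * level6_t w))"
proof -
  obtain C1 C2 where C: "\<And>w. Re w < 0 \<Longrightarrow> alpha w + beta w = C1 * level6_T w"
    "\<And>w. Re w < 0 \<Longrightarrow> alpha w - 3 * beta w = C2 * (level6_t w * level6_T w)"
    using weight1_ratio by blast
  have ev: "eventually (\<lambda>q::complex. q \<in> ball 0 1 - {0}) (at 0)"
    by (rule eventually_at_in_open) auto
  have Re_Ln_neg: "Re (Ln q) < 0" if "q \<in> ball 0 1 - {0}" for q using that by auto
  have "((\<lambda>q. C1 * level6_T (Ln q)) \<longlongrightarrow> C1 * 1) (at 0)"
    by (intro tendsto_intros level6_limits)
  moreover have "eventually (\<lambda>q. C1 * level6_T (Ln q) = alpha (Ln q) + beta (Ln q)) (at 0)"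
    using ev by eventually_elim (simp only: C Re_Ln_neg)
  ultimately have "((\<lambda>q. alpha (Ln q) + beta (Ln q)) \<longlongrightarrow> C1 * 1) (at 0)"
    by (simp only: tendsto_cong)
  from tendsto_unique[OF _ this alpha_beta_limits(1)] have C1: "C1 = 2 * \<i> * sqrt 3 / 3" by simp
  have "((\<lambda>q. C2 * (level6_t (Ln q) / q * level6_T (Ln q))) \<longlongrightarrow> C2 * (1 * 1)) (at 0)"
    by (intro tendsto_intros level6_limits)
  moreover have "eventually (\<lambda>q. C2 * (level6_t (Ln q) / q * level6_T (Ln q)) =
      (alpha (Ln q) - 3 * beta (Ln q)) / q) (at 0)"
    using ev by eventually_elim (simp only: C Re_Ln_neg times_divide_eq_right times_divide_eq_left)
  ultimately have "((\<lambda>q. (alpha (Ln q) - 3 * beta (Ln q)) / q) \<longlongrightarrow> C2 * (1 * 1)) (at 0)"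
    by (simp only: tendsto_cong)
  from tendsto_unique[OF _ this alpha_beta_limits(2)] have C2: "C2 = - 2 * \<i> * sqrt 3" by simp
  define e where "e = \<i> * complex_of_real (sqrt 3)"
  have 1: "3 * (alpha w + beta w) = 2 * e * level6_T w"
    using C(1)[OF w] unfolding C1 e_def by algebra
  have 2: "alpha w - 3 * beta w = - 2 * e * (level6_t w * level6_T w)"
    using C(2)[OF w] unfolding C2 e_def by algebra
  have "2 * alpha w = e * (level6_T w * (1 - level6_t w))"
    "6 * beta w = e * (level6_T w * (1 + 3 * level6_t w))"
    using 1 2 by algebra+
  thus "alpha w = \<i> * sqrt 3 / 2 * (level6_T w * (1 - level6_t w))"
    "beta w = \<i> * sqrt 3 / 6 * (level6_T w * (1 + 3 * level6_t w))"
    by (simp_all add: e_def field_simps)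
qed

text \<open>
After inserting \<open>alpha_beta_conv_level6\<close>, the square \<open>(\<i> \<surd>3)\<^sup>2 = - 3\<close> removes the irrationality.
\<close>

lemma level6_system:
  assumes w: "Re w < 0"
  defines "t \<equiv> level6_t w" and "T \<equiv> level6_T w"
  shows "(level6_t has_field_derivative t * (1 - t) * (1 - 9 * t) * T\<^sup>2) (at w)"
    and "(T_logderiv has_field_derivative
           T_logderiv w ^ 2 + 3 * (t * (1 - t) * (1 - 3 * t) * (1 - 9 * t) * T ^ 4)) (at w)"
proof -
  define e where "e = \<i> * complex_of_real (sqrt 3)"
  have e: "e\<^sup>2 = - 3" by (simp add: e_def power_mult_distrib flip: of_real_power)
  have "alpha w = e / 2 * (T * (1 - t))" "beta w = e / 6 * (T * (1 + 3 * t))"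
    using alpha_beta_conv_level6[OF w] by (simp_all add: e_def t_def T_def)
  hence ab: "2 * alpha w = e * (T * (1 - t))" "6 * beta w = e * (T * (1 + 3 * t))"
    by algebra+
  have eq: "t * (4 * alpha w * (2 * beta w - alpha w)) = t * (1 - t) * (1 - 9 * t) * T\<^sup>2"
  proof -
    have "3 * (4 * alpha w * (2 * beta w - alpha w)) = 2 * alpha w * (2 * (6 * beta w) - 3 * (2 * alpha w))"
      by algebra
    also have "\<dots> = 3 * ((1 - t) * (1 - 9 * t) * T\<^sup>2)"
      unfolding ab using e by algebra
    finally show ?thesis by algebra
  qed
  show "(level6_t has_field_derivative t * (1 - t) * (1 - 9 * t) * T\<^sup>2) (at w)"
    by (rule level6_deriv(1)[OF w, folded t_def, unfolded eq])
  have eq: "- 6 * alpha w * (alpha w - beta w) * (alpha w - 2 * beta w) * (alpha w - 3 * beta w) =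
      3 * (t * (1 - t) * (1 - 3 * t) * (1 - 9 * t) * T ^ 4)"
  proof -
    have "144 * (- 6 * alpha w * (alpha w - beta w) * (alpha w - 2 * beta w) * (alpha w - 3 * beta w)) =
        - 6 * (2 * alpha w) * (3 * (2 * alpha w) - 6 * beta w) * (3 * (2 * alpha w) - 2 * (6 * beta w)) * (2 * alpha w - 6 * beta w)"
      by algebra
    also have "\<dots> = 144 * (3 * (t * (1 - t) * (1 - 3 * t) * (1 - 9 * t) * T ^ 4))"
      unfolding ab using e by algebra
    finally show ?thesis unfolding mult_cancel_left by simp
  qed
  have "T_logderiv w ^ 2 - 6 * alpha w * (alpha w - beta w) * (alpha w - 2 * beta w) * (alpha w - 3 * beta w) =
      T_logderiv w ^ 2 + 3 * (t * (1 - t) * (1 - 3 * t) * (1 - 9 * t) * T ^ 4)"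
    unfolding eq[symmetric] by simp
  with T_logderiv_deriv[OF w] show "(T_logderiv has_field_derivative
           T_logderiv w ^ 2 + 3 * (t * (1 - t) * (1 - 3 * t) * (1 - 9 * t) * T ^ 4)) (at w)"
    by (simp only:)
qed

section \<open>Heun's equation\<close>

theorem theorem10p2:
  fixes U :: "complex set" and \<tau> F :: "complex \<Rightarrow> complex"
  assumes "local_holomorphic_inverse heun_t upper_half_plane U \<tau>"
  defines "F \<equiv> (\<lambda>t. heun_T (\<tau> t))"
  shows "F holomorphic_on U \<and>
    (\<forall>t\<in>U. t \<noteq> 0 \<and> t \<noteq> 1 \<and> t \<noteq> 1 / 9 \<and>
      deriv (deriv F) t
        + (1 / t + 1 / (t - 1) + 1 / (t - 1 / 9)) * deriv F t
        + (t - 1 / 3) / (t * (t - 1) * (t - 1 / 9)) * F t = 0)"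
proof -
  have U: "open U" and hol: "\<tau> holomorphic_on U" and Im: "\<And>t. t \<in> U \<Longrightarrow> Im (\<tau> t) > 0"
    and inv: "\<And>t. t \<in> U \<Longrightarrow> heun_t (\<tau> t) = t"
    using assms(1) by (auto simp: local_holomorphic_inverse_def upper_half_plane_def)
  define w where "w t = of_real pi * \<i> * \<tau> t" for t
  define w' where "w' t = of_real pi * \<i> * deriv \<tau> t" for t
  define u where "u t = T_logderiv (w t)" for t
  define P where "P t = t * (1 - t) * (1 - 9 * t)" for t :: complex
  have w: "Re (w t) < 0" if "t \<in> U" for t
    using Im[OF that] by (simp add: w_def)
  have dw: "(w has_field_derivative w' t) (at t)" if "t \<in> U" for t
    unfolding w_def w'_def by (intro DERIV_cmult holomorphic_derivI[OF hol U that])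
  have t: "level6_t (w t) = t" if "t \<in> U" for t
    using inv[OF that] by (simp add: heun_t_conv w_def)
  have F: "F = (\<lambda>t. level6_T (w t))"
    by (simp add: F_def heun_T_conv w_def)
  have Fnz: "F t \<noteq> 0" if "t \<in> U" for t
    using level6_deriv(4)[OF w[OF that]] by (simp add: F)
  \<comment> \<open>Differentiate \<open>t(w(t)) = t\<close>. In particular \<open>P\<close> has no zero on \<open>U\<close>, which excludes the singular points.\<close>
  have Pw: "P t * F t ^ 2 * w' t = 1" if "t \<in> U" for t
  proof -
    have "((\<lambda>t. level6_t (w t)) has_field_derivative P t * F t ^ 2 * w' t) (at t)"
      using DERIV_chain2[where f = level6_t and g = w, OF level6_system(1)[OF w[OF that]] dw[OF that]]
      by (simp only: t[OF that] P_def F)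
    hence "((\<lambda>t. t) has_field_derivative P t * F t ^ 2 * w' t) (at t)"
      by (rule has_field_derivative_transform_within_open[OF _ U that]) (rule t)
    thus ?thesis using DERIV_unique[OF _ DERIV_ident] by blast
  qed
  have Pnz: "P t \<noteq> 0" if "t \<in> U" for t
    using Pw[OF that] by auto
  have w'_eq: "w' t = 1 / (P t * F t ^ 2)" if "t \<in> U" for t
    using Pw[OF that] Pnz[OF that] Fnz[OF that] by (simp add: field_simps)
  have dF: "(F has_field_derivative u t / (P t * F t)) (at t)" if "t \<in> U" for t
  proof -
    have "(F has_field_derivative F t * u t * w' t) (at t)"
      using DERIV_chain2[where f = level6_T and g = w, OF level6_deriv(2)[OF w[OF that]] dw[OF that]]
      by (simp only: F u_def)
    also have "F t * u t * w' t = u t / (P t * F t)"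
      using w'_eq[OF that] Pnz[OF that] Fnz[OF that] by (simp add: field_simps power2_eq_square)
    finally show ?thesis .
  qed
  have du: "(u has_field_derivative (u t ^ 2 + 3 * (1 - 3 * t) * P t * F t ^ 4) * w' t) (at t)" if "t \<in> U" for t
  proof -
    have "(u has_field_derivative
        (u t ^ 2 + 3 * (t * (1 - t) * (1 - 3 * t) * (1 - 9 * t) * F t ^ 4)) * w' t) (at t)"
      using DERIV_chain2[where f = T_logderiv and g = w, OF level6_system(2)[OF w[OF that]] dw[OF that]]
      by (simp only: t[OF that] F u_def[abs_def])
    moreover have "3 * (t * (1 - t) * (1 - 3 * t) * (1 - 9 * t) * F t ^ 4) = 3 * (1 - 3 * t) * P t * F t ^ 4"
      unfolding P_def by algebra
    ultimately show ?thesis by (simp only:)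
  qed
  have dP: "(P has_field_derivative (1 - 20 * t + 27 * t\<^sup>2)) (at t)" for t
    unfolding P_def[abs_def]
    by (rule derivative_eq_intros refl)+ (simp add: algebra_simps power2_eq_square)
  have holF: "F holomorphic_on U"
    using dF U by (auto simp: holomorphic_on_open)
  have "t \<noteq> 0 \<and> t \<noteq> 1 \<and> t \<noteq> 1 / 9 \<and>
      deriv (deriv F) t + (1 / t + 1 / (t - 1) + 1 / (t - 1 / 9)) * deriv F t
        + (t - 1 / 3) / (t * (t - 1) * (t - 1 / 9)) * F t = 0" if tU: "t \<in> U" for t
  proof -
    note nz = Pnz[OF tU] Fnz[OF tU]
    have "1 - 9 * t \<noteq> 0" using nz(1) by (simp add: P_def)
    hence t_nz: "t \<noteq> 0" "t \<noteq> 1" "t \<noteq> 1 / 9"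
      using nz(1) by (auto simp: P_def mult.commute)
    define F1 F2 where "F1 = deriv F t" and "F2 = deriv (deriv F) t"
    have F1: "P s * F s * deriv F s = u s" if "s \<in> U" for s
      using DERIV_imp_deriv[OF dF[OF that]] Pnz[OF that] Fnz[OF that] by simp
    have dF2: "(deriv F has_field_derivative F2) (at t)"
      unfolding F2_def by (rule holomorphic_derivI[OF holomorphic_deriv[OF holF U] U tU])
    have dF1: "(F has_field_derivative F1) (at t)"
      unfolding F1_def by (rule holomorphic_derivI[OF holF U tU])
    \<comment> \<open>Differentiating \<open>P F F' = u\<close> once more gives the second order equation.\<close>
    have "((\<lambda>s. P s * F s * deriv F s) has_field_derivative
        P t * F t * F2 + (P t * F1 + (1 - 20 * t + 27 * t\<^sup>2) * F t) * F1) (at t)"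
      unfolding F1_def
      by (rule derivative_eq_intros dP dF1[unfolded F1_def] dF2 refl)+ (simp add: algebra_simps)
    hence "(u has_field_derivative
        P t * F t * F2 + (P t * F1 + (1 - 20 * t + 27 * t\<^sup>2) * F t) * F1) (at t)"
      by (rule has_field_derivative_transform_within_open[OF _ U tU]) (rule F1)
    from DERIV_unique[OF this du[OF tU]]
    have "P t * F t ^ 2 * (P t * F t * F2 + (P t * F1 + (1 - 20 * t + 27 * t\<^sup>2) * F t) * F1) =
        (u t ^ 2 + 3 * (1 - 3 * t) * P t * F t ^ 4) * (P t * F t ^ 2 * w' t)"
      by algebra
    also have "\<dots> = (P t * F t * F1)\<^sup>2 + 3 * (1 - 3 * t) * P t * F t ^ 4"
      using F1[OF tU] Pw[OF tU] by (simp add: F1_def)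
    finally have "P t * F t ^ 3 * (P t * F2 + (1 - 20 * t + 27 * t\<^sup>2) * F1 - 3 * (1 - 3 * t) * F t) = 0"
      by algebra
    hence ode: "P t * F2 + (1 - 20 * t + 27 * t\<^sup>2) * F1 - 3 * (1 - 3 * t) * F t = 0"
      using nz by simp
    have P9: "P t = 9 * (t * (t - 1) * (t - 1 / 9))"
      unfolding P_def by algebra
    define D where "D = t * (t - 1) * (t - 1 / 9)"
    have D: "D \<noteq> 0" using nz(1) P9 by (auto simp: D_def)
    have c1: "1 / t + 1 / (t - 1) + 1 / (t - 1 / 9) = (1 - 20 * t + 27 * t\<^sup>2) / (9 * D)"
      unfolding D_def using t_nz by (simp add: divide_simps) algebra
    have "F2 + (1 / t + 1 / (t - 1) + 1 / (t - 1 / 9)) * F1 + (t - 1 / 3) / D * F t =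
        (P t * F2 + (1 - 20 * t + 27 * t\<^sup>2) * F1 - 3 * (1 - 3 * t) * F t) / (9 * D)"
      unfolding c1 P9 D_def[symmetric] using D by (simp add: field_simps)
    hence "F2 + (1 / t + 1 / (t - 1) + 1 / (t - 1 / 9)) * F1 + (t - 1 / 3) / D * F t = 0"
      unfolding ode by simp
    thus ?thesis using t_nz by (simp add: F1_def F2_def D_def)
  qed
  with holF show ?thesis by blast
qed

end
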